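(* Let $L_t$ be a Lévy process on $\mathbb R^d$ with Lévy measure $\nu$, and let $A$ be a $d\times d$ real matrix. Let $\rho_0$ be a non-negative differentiable function on $\mathbb R^d$ such that $\nu(\mathrm dz)\ge\rho_0(z)\,\mathrm dz=:\nu_0(\mathrm dz)$, $\lambda_0:=\int_{\mathbb R^d}\rho_0(z)\,\mathrm dz\in(0,\infty)$, and $$\int_{\mathbb R^d}\Big\{\sup_{x:|x-z|\le\varepsilon}|\nabla\rho_0|(x)\Big\}\mathrm dz<\infty$$ for some $\varepsilon>0$. Realize $L_t=L_t^1+L_t^0$, where $L_t^0=\sum_{i=1}^{N_t}\xi_i$ (with $\sum_{i=1}^0\xi_i=0$) is a compound Poisson process with Lévy measure $\nu_0$: $N_t$ is a Poisson process with rate $\lambda_0$ and jump times $\tau_1<\tau_2<\cdots$, and $\{\xi_i\}$ are i.i.d. with common distribution $\nu_0/\lambda_0$, independent of $(N_t)$; and $L_t^1$ is a Lévy process with Lévy measure $\nu-\nu_0$, independent of $L^0$, such that $L^1+L^0$ has the law of $L$. Let $X_t^x=e^{tA}x+\int_0^te^{(t-s)A}\,\mathrm dL_s$ be the solution of $\mathrm dX_t=AX_t\,\mathrm dt+\mathrm dL_t$, $X_0=x$, and define $$P_t^1f(x)=\mathbb E\big\{f(X_t^x)1_{\{N_t\ge1\}}\big\},\quad f\in\mathscr B_b(\mathbb R^d),\ t>0.$$ Then for any $t>0$ and $f\in\mathscr B_b(\mathbb R^d)$, $P_t^1f$ is differentiable and $$\nabla P_t^1f(x)=-\mathbb E\Big\{f(X_t^x)1_{\{N_t\ge1\}}\frac1{N_t}\sum_{i=1}^{N_t}e^{A^*\tau_i}\nabla\log\rho_0(\xi_i)\Big\},$$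 where $A^*$ is the transpose of $A$. Consequently, if $A\le-\theta I$ for some $\theta\in\mathbb R$, then $$\|\nabla P_t^1f\|_\infty\le\|f\|_\infty\frac{e^{\theta^-t}(1-e^{-\lambda_0t})}{\lambda_0}\int_{\mathbb R^d}|\nabla\rho_0|(z)\,\mathrm dz,\quad t>0,\ f\in\mathscr B_b(\mathbb R^d).$$
   Context: $\mathscr B_b(\mathbb R^d)$ is the set of bounded measurable functions with sup norm $\|\cdot\|_\infty$; $\|\nabla g\|_\infty=\sup_x|\nabla g(x)|$. $\theta^-=\max(-\theta,0)$. $A\le-\theta I$ means $\langle Ax,x\rangle\le-\theta|x|^2$ for all $x$. *)

theory Defs
  imports "HOL-Analysis.Analysis" "HOL-Probability.Probability"
begin

fun matpow :: "real^'n^'n \<Rightarrow> nat \<Rightarrow> real^'n^'n" where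
  "matpow M 0 = mat 1"
| "matpow M (Suc k) = M ** matpow M k"

definition mexp :: "real^'n^'n \<Rightarrow> real^'n^'n" where
  "mexp M = (\<Sum>k. (1 / fact k) *\<^sub>R matpow M k)"

definition grad :: "(real^'n \<Rightarrow> real) \<Rightarrow> real^'n \<Rightarrow> real^'n" where
  "grad f x = (THE g. GDERIV f x :> g)"

definition sup_norm :: "(real^'n \<Rightarrow> real) \<Rightarrow> real" where
  "sup_norm f = (SUP x. \<bar>f x\<bar>)"

definition indep_rv :: "'w measure \<Rightarrow> 'a measure \<Rightarrow> ('w \<Rightarrow> 'a) \<Rightarrow> 'b measure \<Rightarrow> ('w \<Rightarrow> 'b) \<Rightarrow> bool" where
  "indep_rv M Ma X Mb Y \<longleftrightarrow> X \<in> M \<rightarrow>\<^sub>M Ma \<and> Y \<in> M \<rightarrow>\<^sub>M Mb \<and>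
     (\<forall>A\<in>sets Ma. \<forall>B\<in>sets Mb.
        measure M {\<omega>\<in>space M. X \<omega> \<in> A \<and> Y \<omega> \<in> B} =
        measure M {\<omega>\<in>space M. X \<omega> \<in> A} * measure M {\<omega>\<in>space M. Y \<omega> \<in> B})"

definition cadlag :: "(real \<Rightarrow> 'a::metric_space) \<Rightarrow> bool" where
  "cadlag g \<longleftrightarrow> (\<forall>s\<ge>0. continuous (at_right s) g) \<and> (\<forall>s>0. \<exists>l. (g \<longlongrightarrow> l) (at_left s))"

definition left_lim :: "(real \<Rightarrow> 'a::metric_space) \<Rightarrow> real \<Rightarrow> 'a" where
  "left_lim g s = Lim (at_left s) g"

definition levy_process :: "'w measure \<Rightarrow> (real \<Rightarrow> 'w \<Rightarrow> real^'n) \<Rightarrow> bool" where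
  "levy_process M L \<longleftrightarrow> prob_space M \<and> (\<forall>t. L t \<in> borel_measurable M) \<and>
     (\<forall>\<omega>\<in>space M. L 0 \<omega> = 0 \<and> cadlag (\<lambda>t. L t \<omega>)) \<and>
     (\<forall>s t. 0 \<le> s \<longrightarrow> 0 \<le> t \<longrightarrow>
        distr M borel (\<lambda>\<omega>. L (s + t) \<omega> - L s \<omega>) = distr M borel (L t)) \<and>
     (\<forall>(ts::nat \<Rightarrow> real) k. 0 \<le> ts 0 \<longrightarrow> (\<forall>i<k. ts i < ts (Suc i)) \<longrightarrow>
        prob_space.indep_vars M (\<lambda>_. borel) (\<lambda>i \<omega>. L (ts (Suc i)) \<omega> - L (ts i) \<omega>) {..<k})"

text \<open>Expected number of jumps during (0,1] with size in B; for B bounded away from 0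
  this is the Levy measure of B.\<close>
definition jump_intensity :: "'w measure \<Rightarrow> (real \<Rightarrow> 'w \<Rightarrow> real^'n) \<Rightarrow> (real^'n) set \<Rightarrow> ennreal" where
  "jump_intensity M L B =
     (\<integral>\<^sup>+\<omega>. emeasure (count_space UNIV)
        {s \<in> {0<..1}. L s \<omega> - left_lim (\<lambda>r. L r \<omega>) s \<in> B} \<partial>M)"

definition has_levy_measure :: "'w measure \<Rightarrow> (real \<Rightarrow> 'w \<Rightarrow> real^'n) \<Rightarrow> (real^'n) measure \<Rightarrow> bool" where
  "has_levy_measure M L \<nu> \<longleftrightarrow> sets \<nu> = sets borel \<and> emeasure \<nu> {0} = 0 \<and>
     (\<forall>B\<in>sets borel. 0 \<notin> closure B \<longrightarrow> emeasure \<nu> B = jump_intensity M L B)"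

text \<open>Jump times tau_i (i >= 1) of a Poisson process built from interarrival times E 0, E 1, ...\<close>
definition jump_time :: "(nat \<Rightarrow> 'w \<Rightarrow> real) \<Rightarrow> nat \<Rightarrow> 'w \<Rightarrow> real" where
  "jump_time E i \<omega> = (\<Sum>j<i. E j \<omega>)"

definition count_proc :: "(nat \<Rightarrow> 'w \<Rightarrow> real) \<Rightarrow> real \<Rightarrow> 'w \<Rightarrow> nat" where
  "count_proc E t \<omega> = card {i. 1 \<le> i \<and> jump_time E i \<omega> \<le> t}"

definition compound_poisson :: "(nat \<Rightarrow> 'w \<Rightarrow> real) \<Rightarrow> (nat \<Rightarrow> 'w \<Rightarrow> real^'n) \<Rightarrow> real \<Rightarrow> 'w \<Rightarrow> real^'n" where
  "compound_poisson E \<xi> t \<omega> = (\<Sum>i\<in>{1..count_proc E t \<omega>}. \<xi> i \<omega>)"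

text \<open>Pathwise (integration by parts) definition of the Wiener-type integral
  int_0^t e^{(t-s)A} dL_s = L_t + int_0^t A e^{(t-s)A} L_s ds.\<close>
definition ou_int :: "real^'n^'n \<Rightarrow> (real \<Rightarrow> 'w \<Rightarrow> real^'n) \<Rightarrow> real \<Rightarrow> 'w \<Rightarrow> real^'n" where
  "ou_int A L t \<omega> = L t \<omega> + integral {0..t} (\<lambda>s. mexp ((t - s) *\<^sub>R A) *v (A *v L s \<omega>))"

definition ou_proc :: "real^'n^'n \<Rightarrow> (real \<Rightarrow> 'w \<Rightarrow> real^'n) \<Rightarrow> real^'n \<Rightarrow> real \<Rightarrow> 'w \<Rightarrow> real^'n" where
  "ou_proc A L x t \<omega> = mexp (t *\<^sub>R A) *v x + ou_int A L t \<omega>"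

end

theory Submission
  imports Defs
begin

text \<open>
  Given the jump times \<open>\<tau>\<^sub>1 < \<dots> < \<tau>\<^sub>n\<close> in \<open>[0, t]\<close>, the process at time \<open>t\<close> is
  \<open>e\<^bsup>tA\<^esup> x + Y + \<Sum>\<^sub>i e\<^bsup>(t - \<tau>\<^sub>i)A\<^esup> \<xi>\<^sub>i\<close> with \<open>Y\<close> the contribution of \<open>L\<^sup>1\<close>. Moving \<open>x\<close> by \<open>k\<close> has the
  same effect as moving any single \<open>\<xi>\<^sub>i\<close> by \<open>e\<^bsup>\<tau>\<^sub>iA\<^esup> k\<close>, and this can be undone by a translation of
  Lebesgue measure, which replaces \<open>\<rho>\<^sub>0(z)\<close> by \<open>\<rho>\<^sub>0(z - e\<^bsup>\<tau>\<^sub>iA\<^esup> k)\<close>. To first order this is a factor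
  \<open>1 - \<langle>\<nabla> log \<rho>\<^sub>0(z), e\<^bsup>\<tau>\<^sub>iA\<^esup> k\<rangle>\<close>, with an \<open>L\<^sup>1\<close> error \<open>o(|k|)\<close> uniformly in the times, by dominated
  convergence; averaging over \<open>i \<le> n\<close> gives the formula.

  The hypotheses make \<open>L\<^sup>1\<close> independent of the path of \<open>L\<^sup>0\<close> only, not of the times and marks from
  which it is built. Almost surely, however, the marks are nonzero and the times are distinct, so that
  times and marks up to \<open>t\<close> are limits of measurable functions of finitely many increments of \<open>L\<^sup>0\<close>.
\<close>

section \<open>The matrix exponential\<close>

text \<open>Since \<open>f\<close> is only bounded and measurable, \<open>f (X + c) - f X\<close> is
  never small pointwise; only its mean over one mark is. Every estimate therefore keeps the absolute
  value outside the innermost expectation while conditioning twice: on the contribution of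
  \<open>L1\<close>, then on the interarrival times. The first conditioning needs \<open>L1\<close>
  to be independent of three sums jointly (jump part of the process, count, weight), so these are
  carried as one vector-valued sum over the jumps. Its summand is continuous in the time but merely
  Borel in the mark, because the score is; hence the marks are recovered exactly from increments and
  only the times are approximated.

  Averaging over \<open>i\<close> keeps the weight integrable without any moment of the count: given
  \<open>n \<ge> 1\<close> jumps, the average of the score norms has mean
  \<open>(\<integral> |grad rho|) / lam\<close> whatever \<open>n\<close> is, and the probability of
  at least one jump supplies the remaining factor of the constant in the estimate. Differentiability
  for a general matrix uses the same bound on \<open>mexp\<close>, since every matrix satisfies the
  dissipativity inequality for some real rate.\<close>

lemma bounded_bilinear_matrix_mult: "bounded_bilinear ((**) :: real^'n^'m \<Rightarrow> real^'k^'n \<Rightarrow> real^'k^'m)"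
proof -
  have "bilinear ((**) :: real^'n^'m \<Rightarrow> real^'k^'n \<Rightarrow> real^'k^'m)"
    unfolding bilinear_def
    by (auto intro!: linearI simp: matrix_matrix_mult_def vec_eq_iff distrib_left distrib_right sum.distrib sum_distrib_left mult.assoc mult.left_commute)
  then show ?thesis by (simp add: bilinear_conv_bounded_bilinear)
qed

lemma bounded_bilinear_matrix_vector_mult: "bounded_bilinear ((*v) :: real^'n^'m \<Rightarrow> real^'n \<Rightarrow> real^'m)"
proof -
  have "bilinear ((*v) :: real^'n^'m \<Rightarrow> real^'n \<Rightarrow> real^'m)"
    unfolding bilinear_def
    by (auto intro!: linearI simp: matrix_vector_right_distrib matrix_vector_mult_add_rdistrib
        scaleR_matrix_vector_assoc matrix_vector_mult_scaleR)
  then show ?thesis by (simp add: bilinear_conv_bounded_bilinear)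
qed

lemma bounded_linear_transpose: "bounded_linear (transpose :: real^'n^'m \<Rightarrow> real^'m^'n)"
proof -
  have "linear (transpose :: real^'n^'m \<Rightarrow> real^'m^'n)"
    by (auto intro!: linearI simp: transpose_def vec_eq_iff)
  then show ?thesis by (simp add: linear_conv_bounded_linear)
qed

lemmas matrix_mult_scaleR_left = bounded_bilinear.scaleR_left[OF bounded_bilinear_matrix_mult]
lemmas matrix_mult_scaleR_right = bounded_bilinear.scaleR_right[OF bounded_bilinear_matrix_mult]

lemma matpow_commute: "matpow M k ** M = M ** matpow M k"
  by (induction k) (auto simp: matrix_mul_assoc[symmetric])

lemma matpow_scaleR: "matpow (s *\<^sub>R M) k = s ^ k *\<^sub>R matpow M k"
  by (induction k) (auto simp: matrix_mult_scaleR_left matrix_mult_scaleR_right)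

lemma matpow_transpose: "matpow (transpose M) k = transpose (matpow M k)"
  by (induction k) (auto simp: matrix_transpose_mul matpow_commute[symmetric])

lemma norm_matpow_le: "\<exists>C c. \<forall>k. norm (matpow (M :: real^'n^'n) k) \<le> C * c ^ k"
proof -
  obtain K where K: "K > 0" "\<And>(a::real^'n^'n) (b::real^'n^'n). norm (a ** b) \<le> norm a * norm b * K"
    using bounded_bilinear.pos_bounded[OF bounded_bilinear_matrix_mult] by blast
  \<comment> \<open>The norm on matrices is the Euclidean norm of the entries, used only through a
    bilinear bound: \<open>K\<close> replaces submultiplicativity, and the identity need not have
    norm 1.\<close>
  have "norm (matpow M k) \<le> norm (mat 1 :: real^'n^'n) * (norm M * K) ^ k" for k
  proof (induction k)
    case (Suc k)
    have "norm (matpow M (Suc k)) \<le> norm (matpow M k) * (norm M * K)"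
      using K(2)[of M "matpow M k"] by (simp add: ac_simps)
    also have "\<dots> \<le> norm (mat 1 :: real^'n^'n) * (norm M * K) ^ k * (norm M * K)"
      using Suc K(1) by (intro mult_right_mono) auto
    finally show ?case by (simp add: ac_simps)
  qed simp
  then show ?thesis by blast
qed

lemma summable_mexp: "summable (\<lambda>k. (1 / fact k) *\<^sub>R matpow (M :: real^'n^'n) k)"
proof -
  obtain C c where *: "\<And>k. norm (matpow M k) \<le> C * c ^ k" using norm_matpow_le[of M] by blast
  have "summable (\<lambda>k. C * (inverse (fact k) * c ^ k))"
    by (intro summable_mult summable_exp)
  then show ?thesis
    by (rule summable_comparison_test'[where N=0])
       (use * in \<open>auto simp: divide_simps mult.commute\<close>)
qed

lemma mexp_sums: "(\<lambda>k. (1 / fact k) *\<^sub>R matpow M k) sums mexp M"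
  unfolding mexp_def by (rule summable_sums[OF summable_mexp])

lemma mexp_0 [simp]: "mexp (0 :: real^'n^'n) = mat 1"
proof -
  have "matpow (0 :: real^'n^'n) k = (if k = 0 then mat 1 else 0)" for k
    by (cases k) (auto simp: matrix_matrix_mult_def vec_eq_iff)
  then have "(\<lambda>k. (1 / fact k) *\<^sub>R matpow (0 :: real^'n^'n) k) = (\<lambda>k. if k = 0 then mat 1 else 0)"
    by (auto simp: fun_eq_iff)
  then show ?thesis
    using mexp_sums[of "0 :: real^'n^'n"] sums_single[of 0 "\<lambda>_. mat 1 :: real^'n^'n"] sums_unique2 by metis
qed

lemma mexp_transpose: "mexp (transpose M) = transpose (mexp M)"
proof -
  have "(\<lambda>k. transpose ((1 / fact k) *\<^sub>R matpow M k)) sums transpose (mexp M)"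
    by (rule bounded_linear.sums[OF bounded_linear_transpose mexp_sums])
  moreover have "transpose ((1 / fact k) *\<^sub>R matpow M k) = (1 / fact k) *\<^sub>R matpow (transpose M) k" for k
    by (simp add: matpow_transpose linear_cmul[OF bounded_linear.linear[OF bounded_linear_transpose]])
  ultimately show ?thesis using mexp_sums[of "transpose M"] sums_unique2 by (metis (no_types, lifting) sums_cong)
qed

lemma mexp_scaleR_commute: "mexp (s *\<^sub>R M) ** M = M ** mexp (s *\<^sub>R M)"
proof -
  have "(\<lambda>k. ((1 / fact k) *\<^sub>R matpow (s *\<^sub>R M) k) ** M) sums (mexp (s *\<^sub>R M) ** M)"
    by (rule bounded_linear.sums[OF bounded_bilinear.bounded_linear_left[OF bounded_bilinear_matrix_mult] mexp_sums])
  moreover have "(\<lambda>k. M ** ((1 / fact k) *\<^sub>R matpow (s *\<^sub>R M) k)) sums (M ** mexp (s *\<^sub>R M))"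
    by (rule bounded_linear.sums[OF bounded_bilinear.bounded_linear_right[OF bounded_bilinear_matrix_mult] mexp_sums])
  moreover have "((1 / fact k) *\<^sub>R matpow (s *\<^sub>R M) k) ** M = M ** ((1 / fact k) *\<^sub>R matpow (s *\<^sub>R M) k)" for k
    by (simp add: matpow_scaleR matrix_mult_scaleR_left matrix_mult_scaleR_right matpow_commute)
  ultimately show ?thesis using sums_unique2 by (metis (no_types, lifting) sums_cong)
qed

text \<open>Each entry is an everywhere convergent scalar power series in \<open>s\<close>, so it
  may be differentiated term by term; the factor \<open>Suc k\<close> from \<open>diffs\<close>
  cancels against the factorial and the index shift leaves one extra factor
  \<open>M\<close>.\<close>

lemma has_vector_derivative_mexp:
  "((\<lambda>s. mexp (s *\<^sub>R M)) has_vector_derivative mexp (s *\<^sub>R M) ** M) (at s within S)"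
proof -
  have "((\<lambda>s. mexp (s *\<^sub>R M) \<bullet> i) has_real_derivative (mexp (s *\<^sub>R M) ** M) \<bullet> i) (at s)" if "i \<in> Basis" for i
  proof -
    define c where "c k = (1 / fact k) *\<^sub>R matpow M (k::nat) \<bullet> i" for k
    have c: "(\<lambda>k. c k * x ^ k) sums (mexp (x *\<^sub>R M) \<bullet> i)" for x
      using bounded_linear.sums[OF bounded_linear_inner_left mexp_sums[of "x *\<^sub>R M"], of i]
      by (simp add: c_def matpow_scaleR mult_ac)
    have "DERIV (\<lambda>x. \<Sum>k. c k * x ^ k) s :> (\<Sum>k. diffs c k * s ^ k)"
      by (rule termdiffs_strong_converges_everywhere) (rule sums_summable[OF c])
    moreover have "(\<lambda>x. \<Sum>k. c k * x ^ k) = (\<lambda>x. mexp (x *\<^sub>R M) \<bullet> i)"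
      using c by (auto simp: sums_iff)
    moreover have "(\<lambda>k. diffs c k * s ^ k) sums ((mexp (s *\<^sub>R M) ** M) \<bullet> i)"
    proof -
      have "(\<lambda>k. (((1 / fact k) *\<^sub>R matpow (s *\<^sub>R M) k) ** M) \<bullet> i) sums ((mexp (s *\<^sub>R M) ** M) \<bullet> i)"
        by (intro bounded_linear.sums[OF bounded_linear_inner_left]
            bounded_linear.sums[OF bounded_bilinear.bounded_linear_left[OF bounded_bilinear_matrix_mult] mexp_sums])
      moreover have "(((1 / fact k) *\<^sub>R matpow (s *\<^sub>R M) k) ** M) \<bullet> i = diffs c k * s ^ k" for k
        by (simp add: matpow_scaleR matrix_mult_scaleR_left matpow_commute c_def diffs_def
            divide_simps del: of_nat_Suc)
      ultimately show ?thesis by simp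
    qed
    ultimately show ?thesis by (simp add: sums_iff)
  qed
  then have "((\<lambda>s. mexp (s *\<^sub>R M)) has_derivative (\<lambda>x. x *\<^sub>R (mexp (s *\<^sub>R M) ** M))) (at s)"
    by (subst has_derivative_componentwise_within)
       (auto simp: has_field_derivative_def mult_commute_abs)
  then show ?thesis
    by (auto simp: has_vector_derivative_def intro: has_derivative_at_withinI)
qed

lemma has_vector_derivative_mexp_vec:
  "((\<lambda>s. mexp (s *\<^sub>R M) *v v) has_vector_derivative mexp (s *\<^sub>R M) *v (M *v v)) (at s within S)"
  using bounded_linear.has_vector_derivative[OF
      bounded_bilinear.bounded_linear_left[OF bounded_bilinear_matrix_vector_mult] has_vector_derivative_mexp]
  by (simp add: matrix_vector_mul_assoc)

lemma continuous_on_mexp: "continuous_on S (\<lambda>s. mexp (s *\<^sub>R M))"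
  by (rule continuous_on_vector_derivative[OF has_vector_derivative_mexp])

lemma has_vector_derivative_mexp_reflect:
  "((\<lambda>s. mexp ((t - s) *\<^sub>R M)) has_vector_derivative - (mexp ((t - s) *\<^sub>R M) ** M)) (at s within S)"
proof -
  have "((\<lambda>s. t - s) has_vector_derivative -1) (at s within S)"
    by (auto intro!: derivative_eq_intros)
  from vector_diff_chain_within[OF this has_vector_derivative_mexp[of M]]
  show ?thesis by (simp add: o_def)
qed

text \<open>\<open>M\<close> commutes with its exponential, so the two terms of the product rule in
  \<open>s\<close> cancel; the product is constant and equals its value at
  \<open>s = 0\<close>.\<close>

lemma mexp_semigroup: "mexp ((t - s) *\<^sub>R M) ** mexp (s *\<^sub>R (M :: real^'n^'n)) = mexp (t *\<^sub>R M)"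
proof -
  have "((\<lambda>s. mexp ((t - s) *\<^sub>R M) ** mexp (s *\<^sub>R M)) has_vector_derivative 0) (at r within UNIV)" for r
  proof -
    have "((\<lambda>s. mexp ((t - s) *\<^sub>R M) ** mexp (s *\<^sub>R M)) has_vector_derivative
        (mexp ((t - r) *\<^sub>R M) ** (mexp (r *\<^sub>R M) ** M) + (- (mexp ((t - r) *\<^sub>R M) ** M)) ** mexp (r *\<^sub>R M)))
        (at r within UNIV)"
      by (rule bounded_bilinear.has_vector_derivative[OF bounded_bilinear_matrix_mult
            has_vector_derivative_mexp_reflect has_vector_derivative_mexp])
    moreover have "(- a) ** b = - (a ** b)" for a b :: "real^'n^'n"
      using bounded_bilinear.minus_left[OF bounded_bilinear_matrix_mult] .
    ultimately show ?thesis by (simp add: matrix_mul_assoc[symmetric] mexp_scaleR_commute[of r])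
  qed
  then obtain c where "\<And>s. mexp ((t - s) *\<^sub>R M) ** mexp (s *\<^sub>R M) = c"
    using has_vector_derivative_zero_constant[of UNIV "\<lambda>s. mexp ((t - s) *\<^sub>R M) ** mexp (s *\<^sub>R M)"] by auto
  from this[of s] this[of 0] show ?thesis by simp
qed

text \<open>Energy estimate: \<open>exp (2 * \<theta> * r)\<close> times the squared norm of
  \<open>y r\<close> is nonincreasing along the linear flow. Passing from
  \<open>- \<theta> * s\<close> to \<open>max (- \<theta>) 0 * t\<close> makes the bound uniform in
  \<open>s\<close>, and is where the negative part of \<open>\<theta>\<close> enters the final
  constant.\<close>

lemma norm_mexp_le:
  fixes A :: "real^'n^'n"
  assumes diss: "\<And>v. v \<bullet> (A *v v) \<le> - \<theta> * (norm v)\<^sup>2" and s: "0 \<le> s" "s \<le> t"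
  shows "norm (mexp (s *\<^sub>R A) *v v) \<le> exp (max (- \<theta>) 0 * t) * norm v"
proof -
  define y where "y r = mexp (r *\<^sub>R A) *v v" for r
  have y': "(y has_vector_derivative A *v y r) (at r)" for r
    using has_vector_derivative_mexp_vec[of A v r UNIV]
    by (simp add: y_def[abs_def] matrix_vector_mul_assoc mexp_scaleR_commute)
  define \<phi> where "\<phi> r = exp (2 * \<theta> * r) * (y r \<bullet> y r)" for r
  have "(\<phi> has_real_derivative exp (2 * \<theta> * r) * (2 * \<theta> * (y r \<bullet> y r) + 2 * (y r \<bullet> (A *v y r)))) (at r)" for r
  proof -
    have "((\<lambda>r. y r \<bullet> y r) has_real_derivative 2 * (y r \<bullet> (A *v y r))) (at r)"
      using bounded_bilinear.has_vector_derivative[OF bounded_bilinear_inner y'[of r] y'[of r]]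
      by (simp add: has_real_derivative_iff_has_vector_derivative inner_commute)
    then show ?thesis unfolding \<phi>_def
      by (auto intro!: derivative_eq_intros simp: algebra_simps)
  qed
  moreover have "exp (2 * \<theta> * r) * (2 * \<theta> * (y r \<bullet> y r) + 2 * (y r \<bullet> (A *v y r))) \<le> 0" for r
    using diss[of "y r"] by (intro mult_nonneg_nonpos) (auto simp: power2_norm_eq_inner)
  ultimately have "\<phi> s \<le> \<phi> 0"
    by (intro DERIV_nonpos_imp_nonincreasing[OF s(1)]) blast
  then have "y s \<bullet> y s \<le> exp (- 2 * \<theta> * s) * (v \<bullet> v)"
    by (simp add: \<phi>_def y_def exp_minus field_simps)
  also have "\<dots> \<le> exp (2 * (max (- \<theta>) 0 * t)) * (v \<bullet> v)"
  proof -
    have "- \<theta> * s \<le> max (- \<theta>) 0 * t"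
      using s by (intro mult_mono) auto
    then show ?thesis by (intro mult_right_mono) (auto simp: mult.commute)
  qed
  also have "\<dots> = (exp (max (- \<theta>) 0 * t) * norm v)\<^sup>2"
    by (simp add: power_mult_distrib power2_norm_eq_inner exp_double)
  finally have "(norm (y s))\<^sup>2 \<le> (exp (max (- \<theta>) 0 * t) * norm v)\<^sup>2"
    by (simp add: power2_norm_eq_inner)
  then show ?thesis unfolding y_def by (rule power2_le_imp_le) auto
qed

text \<open>Boundedness of \<open>A\<close> gives \<open>\<theta> = - B\<close>. Through this,
  \<open>norm_mexp_le\<close> also bounds the exponentials of an arbitrary matrix uniformly on
  compact time intervals.\<close>

lemma dissipative_ex: "\<exists>\<theta>. \<forall>v. v \<bullet> ((A :: real^'n^'n) *v v) \<le> - \<theta> * (norm v)\<^sup>2"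
proof -
  obtain B where B: "\<And>v. norm (A *v v) \<le> norm v * B"
    using bounded_linear.bounded[OF matrix_vector_mul_bounded_linear[of A]] by blast
  have "v \<bullet> (A *v v) \<le> B * (norm v)\<^sup>2" for v
    using norm_cauchy_schwarz[of v "A *v v"] mult_left_mono[OF B[of v], of "norm v"]
    by (simp add: power2_eq_square ac_simps)
  then show ?thesis by (intro exI[of _ "-B"]) simp
qed

text \<open>The integral term of \<open>ou_int\<close> for a path with a single jump
  \<open>z\<close> at time \<open>\<tau>\<close>; adding the endpoint value \<open>z\<close> leaves
  exactly the propagated jump \<open>mexp ((t - \<tau>) A) z\<close>.\<close>

lemma has_integral_mexp_step:
  assumes "0 \<le> \<tau>" "\<tau> \<le> t"
  shows "((\<lambda>s. if \<tau> \<le> s then mexp ((t - s) *\<^sub>R A) *v (A *v z) else 0) has_integral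
     (mexp ((t - \<tau>) *\<^sub>R A) *v z - z)) {0..t}"
proof -
  have "((\<lambda>s. mexp ((t - s) *\<^sub>R A) *v (A *v z)) has_integral
     (- (mexp ((t - t) *\<^sub>R A) *v z) - - (mexp ((t - \<tau>) *\<^sub>R A) *v z))) {\<tau>..t}"
  proof (rule fundamental_theorem_of_calculus)
    fix s
    have "((\<lambda>s. - (mexp ((t - s) *\<^sub>R A) *v z)) has_vector_derivative
      - ((- (mexp ((t - s) *\<^sub>R A) ** A)) *v z)) (at s within {\<tau>..t})"
      by (intro has_vector_derivative_minus bounded_linear.has_vector_derivative[OF
          bounded_bilinear.bounded_linear_left[OF bounded_bilinear_matrix_vector_mult]]
          has_vector_derivative_mexp_reflect)
    then show "((\<lambda>s. - (mexp ((t - s) *\<^sub>R A) *v z)) has_vector_derivative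
        mexp ((t - s) *\<^sub>R A) *v (A *v z)) (at s within {\<tau>..t})"
      by (simp add: bounded_bilinear.minus_left[OF bounded_bilinear_matrix_vector_mult] matrix_vector_mul_assoc)
  qed (use assms in auto)
  then have "((\<lambda>s. if s \<in> {\<tau>..t} then mexp ((t - s) *\<^sub>R A) *v (A *v z) else 0) has_integral
     (mexp ((t - \<tau>) *\<^sub>R A) *v z - z)) {0..t}"
    using assms by (subst has_integral_restrict) auto
  then show ?thesis
    by (rule has_integral_eq[rotated]) auto
qed

section \<open>Densities with integrable local supremum of the gradient\<close>

lemma GDERIV_unique:
  assumes "GDERIV f x :> g" "GDERIV f x :> g'"
  shows "g = g'"
proof -
  have "(\<lambda>h. h \<bullet> g) = (\<lambda>h. h \<bullet> g')"
    using assms unfolding gderiv_def by (rule has_derivative_unique)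
  then show ?thesis by (metis vector_eq_ldot)
qed

text \<open>\<open>grad\<close> is a definite description, so existence must be supplied: the vector
  \<open>g\<close> of values of the derivative on the basis represents it as an inner
  product.\<close>

lemma gderiv_grad:
  fixes f :: "real^'n \<Rightarrow> real"
  assumes "f differentiable (at x)"
  shows "GDERIV f x :> grad f x"
proof -
  obtain D where D: "(f has_derivative D) (at x)" using assms by (auto simp: differentiable_def)
  then interpret D: bounded_linear D by (rule has_derivative_bounded_linear)
  define g where "g = (\<Sum>i\<in>Basis. D i *\<^sub>R i)"
  have "D h = h \<bullet> g" for h
  proof -
    have "D h = D (\<Sum>i\<in>Basis. (h \<bullet> i) *\<^sub>R i)" by (simp add: euclidean_representation)
    also have "\<dots> = h \<bullet> g" by (simp add: D.sum D.scaleR g_def inner_sum_right mult.commute)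
    finally show ?thesis .
  qed
  then have "GDERIV f x :> g" using D by (auto simp: gderiv_def elim!: has_derivative_eq_rhs)
  then show ?thesis unfolding grad_def by (rule theI) (auto intro: GDERIV_unique \<open>GDERIV f x :> g\<close>)
qed

lemma grad_eqI: "GDERIV f x :> g \<Longrightarrow> grad f x = g"
  unfolding grad_def by (rule the_equality) (auto intro: GDERIV_unique)

text \<open>A sequential form of the directional derivative, so that measurability of
  \<open>f\<close> passes to the coordinates of \<open>grad f\<close>.\<close>

lemma gderiv_directional_limit:
  fixes f :: "real^'n \<Rightarrow> real"
  assumes "GDERIV f x :> g"
  shows "(\<lambda>n. (f (x + (1 / real (Suc n)) *\<^sub>R b) - f x) * real (Suc n)) \<longlonglongrightarrow> g \<bullet> b"
proof -
  have "((\<lambda>s. f (x + s *\<^sub>R b)) has_real_derivative g \<bullet> b) (at 0)"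
  proof -
    have "((\<lambda>s. x + s *\<^sub>R b) has_derivative (\<lambda>s. s *\<^sub>R b)) (at 0)"
      by (auto intro!: derivative_eq_intros)
    moreover have "(f has_derivative (\<lambda>h. h \<bullet> g)) (at (x + 0 *\<^sub>R b))"
      using assms by (simp add: gderiv_def)
    ultimately have "((\<lambda>s. f (x + s *\<^sub>R b)) has_derivative (\<lambda>s. (s *\<^sub>R b) \<bullet> g)) (at 0)"
      by (rule has_derivative_compose)
    then show ?thesis
      by (simp add: has_field_derivative_def inner_commute mult_commute_abs)
  qed
  then have "((\<lambda>h. (f (x + h *\<^sub>R b) - f x) / h) \<longlongrightarrow> g \<bullet> b) (at 0)"
    by (simp add: DERIV_def)
  moreover have "filterlim (\<lambda>n. 1 / real (Suc n)) (at 0) sequentially"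
    using LIMSEQ_Suc[OF lim_1_over_n[where 'a=real]] by (auto simp: filterlim_at)
  ultimately have "((\<lambda>n. (f (x + (1 / real (Suc n)) *\<^sub>R b) - f x) / (1 / real (Suc n))) \<longlongrightarrow> g \<bullet> b) sequentially"
    by (rule filterlim_compose)
  then show ?thesis by simp
qed

lemma differentiable_borel_measurable:
  fixes f :: "real^'n \<Rightarrow> real"
  assumes "\<And>z. f differentiable (at z)"
  shows "f \<in> borel_measurable borel"
  using assms by (intro borel_measurable_continuous_onI continuous_at_imp_continuous_on)
    (auto intro: differentiable_imp_continuous_within)

lemma borel_measurable_grad:
  fixes f :: "real^'n \<Rightarrow> real"
  assumes "\<And>z. f differentiable (at z)"
  shows "grad f \<in> borel_measurable borel"
proof (subst borel_measurable_euclidean_space, intro ballI)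
  fix b :: "real^'n" assume "b \<in> Basis"
  have [measurable]: "f \<in> borel_measurable borel" by (rule differentiable_borel_measurable[OF assms])
  show "(\<lambda>x. grad f x \<bullet> b) \<in> borel_measurable borel"
    by (rule borel_measurable_LIMSEQ_real[OF gderiv_directional_limit[OF gderiv_grad[OF assms]]]) measurable
qed

section \<open>The score of a nonnegative differentiable density\<close>

locale smooth_density =
  fixes rho :: "real^'n \<Rightarrow> real"
  assumes nonneg: "\<And>z. 0 \<le> rho z"
    and differentiable: "\<And>z. rho differentiable (at z)"
begin

definition score :: "real^'n \<Rightarrow> real^'n" where "score = grad (\<lambda>z. ln (rho z))"

lemma rho_measurable [measurable]: "rho \<in> borel_measurable borel"
  by (rule differentiable_borel_measurable[OF differentiable])

lemma grad_rho_measurable [measurable]: "grad rho \<in> borel_measurable borel"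
  by (rule borel_measurable_grad[OF differentiable])

lemma continuous_rho: "continuous_on UNIV rho"
  by (intro continuous_at_imp_continuous_on) (auto intro: differentiable_imp_continuous_within differentiable)

text \<open>A zero of a nonnegative function is a minimum, hence a critical point.\<close>

lemma grad_rho_eq_0:
  assumes "rho z = 0" shows "grad rho z = 0"
proof -
  have "(rho has_derivative (\<lambda>h. h \<bullet> grad rho z)) (at z)"
    using gderiv_grad[OF differentiable[of z]] by (simp add: gderiv_def)
  then have "(\<lambda>h. h \<bullet> grad rho z) = (\<lambda>h. 0)"
    by (rule has_derivative_local_min) (simp add: assms nonneg)
  then have "grad rho z \<bullet> grad rho z = 0" by metis
  then show ?thesis by simp
qed

lemma score_pos:
  assumes "rho z > 0" shows "score z = grad rho z /\<^sub>R rho z"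
proof -
  have "GDERIV (\<lambda>z. ln (rho z)) z :> inverse (rho z) *\<^sub>R grad rho z"
    by (rule GDERIV_DERIV_compose[OF gderiv_grad[OF differentiable]]) (rule DERIV_ln[OF assms])
  then show ?thesis unfolding score_def by (rule grad_eqI)
qed

text \<open>At zeros of \<open>rho\<close> both sides vanish, whatever value the score has there;
  integrals of the score against the density thus only see \<open>grad rho\<close>.\<close>

lemma rho_score: "rho z *\<^sub>R score z = grad rho z"
  using nonneg[of z] by (cases "rho z = 0") (auto simp: grad_rho_eq_0 score_pos)

text \<open>Since \<open>ln 0 = 0\<close>, the function \<open>ln \<circ> rho\<close> vanishes where \<open>rho\<close> does; at boundary points of
  that set it is discontinuous, and there \<open>grad\<close> takes one fixed unspecified value.\<close>

lemma score_cases: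
  "score z = (if rho z > 0 then grad rho z /\<^sub>R rho z
     else if z \<in> interior {z. rho z = 0} then 0 else (THE g. False))"
proof -
  consider "rho z > 0" | "rho z = 0" "z \<in> interior {z. rho z = 0}"
    | "rho z = 0" "z \<notin> interior {z. rho z = 0}"
    using nonneg[of z] by fastforce
  then show ?thesis
  proof cases
    case 2
    have "GDERIV (\<lambda>z. ln (rho z)) z :> 0"
      unfolding gderiv_def
    proof (rule has_derivative_transform_within_open)
      show "((\<lambda>_. 0) has_derivative (\<lambda>h. h \<bullet> 0)) (at z)" by simp
      show "open (interior {z. rho z = 0})" "z \<in> interior {z. rho z = 0}" using 2 by auto
      show "0 = ln (rho y)" if "y \<in> interior {z. rho z = 0}" for y
        using subsetD[OF interior_subset that] by simp
    qed
    then have "score z = 0" unfolding score_def by (rule grad_eqI)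
    then show ?thesis using 2 by simp
  next
    case 3
    have "\<not> (GDERIV (\<lambda>z. ln (rho z)) z :> g)" for g
    proof
      assume "GDERIV (\<lambda>z. ln (rho z)) z :> g"
      then have "isCont (\<lambda>z. ln (rho z)) z" unfolding gderiv_def by (rule has_derivative_continuous)
      \<comment> \<open>Near \<open>z\<close>, continuity keeps \<open>ln (rho y)\<close> above -1,
        because \<open>ln 0 = 0\<close>, and keeps \<open>rho y\<close> below
        \<open>exp (-1)\<close>. A positive value of \<open>rho\<close> in this range has logarithm
        below -1, so \<open>rho\<close> would vanish on a whole neighbourhood.\<close>
      then have "\<forall>\<^sub>F y in nhds z. ln (rho y) \<in> {-1<..}"
        using 3 by (intro topological_tendstoD[of _ 0]) (auto simp: isCont_def tendsto_nhds_iff)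
      moreover have "\<forall>\<^sub>F y in nhds z. rho y \<in> {..<exp (-1)}"
      proof -
        have "isCont rho z" using continuous_rho by (simp add: continuous_on_eq_continuous_at)
        then show ?thesis
          using 3 by (intro topological_tendstoD[of _ 0]) (auto simp: isCont_def tendsto_nhds_iff)
      qed
      ultimately have "\<forall>\<^sub>F y in nhds z. rho y = 0"
      proof eventually_elim
        case (elim y)
        show ?case
        proof (rule ccontr)
          assume "rho y \<noteq> 0"
          then have "rho y > 0" using nonneg[of y] by simp
          then have "ln (rho y) < ln (exp (-1))" using elim by (subst ln_less_cancel_iff) auto
          then show False using elim by simp
        qed
      qed
      then have "z \<in> interior {z. rho z = 0}"
        by (auto simp: eventually_nhds interior_def)
      then show False using 3 by simp
    qed
    \<comment> \<open>The predicate under \<open>THE\<close> is the constant false one at every such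
      point, so all of them share the same value of \<open>grad\<close>.\<close>
    then have "gderiv (\<lambda>z. ln (rho z)) z = (\<lambda>g. False)" by blast
    then have "score z = (THE g. False)" unfolding score_def grad_def by (rule arg_cong)
    then show ?thesis using 3 by simp
  qed (simp add: score_pos)
qed

lemma score_measurable [measurable]: "score \<in> borel_measurable borel"
proof -
  have [measurable]: "interior {z. rho z = 0} \<in> sets borel" by simp
  have "(\<lambda>z. if rho z > 0 then grad rho z /\<^sub>R rho z
     else if z \<in> interior {z. rho z = 0} then 0 else (THE g. False)) \<in> borel_measurable borel"
    by measurable
  then show ?thesis by (subst (asm) score_cases[symmetric, abs_def])
qed

end

text \<open>No measurability of \<open>F\<close> is assumed: the supremum exceeds \<open>a\<close>
  exactly on the union of the open balls centred at points where \<open>F\<close> exceeds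
  \<open>a\<close>, which is open.\<close>

lemma borel_measurable_SUP_ball:
  fixes F :: "'a::metric_space \<Rightarrow> ennreal"
  shows "(\<lambda>z. SUP x\<in>ball z \<epsilon>. F x) \<in> borel_measurable borel"
proof (rule borel_measurableI_greater)
  fix a :: ennreal
  have "{z. a < (SUP x\<in>ball z \<epsilon>. F x)} = (\<Union>x\<in>{x. a < F x}. ball x \<epsilon>)"
    by (auto simp: less_SUP_iff dist_commute)
  moreover have "open (\<Union>x\<in>{x. a < F x}. ball x \<epsilon>)" by blast
  ultimately show "{z \<in> space borel. a < (SUP x\<in>ball z \<epsilon>. F x)} \<in> sets borel"
    by simp
qed

locale smooth_density_grad = smooth_density rho for rho :: "real^'n \<Rightarrow> real" +
  fixes \<epsilon> :: real
  assumes eps_pos: "0 < \<epsilon>"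
    and sup_finite: "(\<integral>\<^sup>+z. (SUP x\<in>cball z \<epsilon>. ennreal (norm (grad rho x))) \<partial>lborel) < \<infinity>"
begin

definition gsup :: "real^'n \<Rightarrow> ennreal" where "gsup z = (SUP x\<in>ball z \<epsilon>. ennreal (norm (grad rho x)))"

text \<open>The supremum over closed balls need not be Borel measurable (its \<open>nn_integral\<close> is then a lower
  integral), but the one over open balls is lower semicontinuous.\<close>

lemma gsup_measurable [measurable]: "gsup \<in> borel_measurable borel"
  unfolding gsup_def[abs_def] by (rule borel_measurable_SUP_ball)

lemma nn_integral_gsup: "(\<integral>\<^sup>+z. gsup z \<partial>lborel) < \<infinity>"
proof (rule le_less_trans[OF nn_integral_mono sup_finite])
  show "gsup z \<le> (SUP x\<in>cball z \<epsilon>. ennreal (norm (grad rho x)))" for z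
    unfolding gsup_def by (rule SUP_subset_mono) auto
qed

lemma integrable_gsup: "integrable lborel (\<lambda>z. enn2real (gsup z))"
  and gsup_finite: "AE z in lborel. gsup z < \<infinity>"
proof -
  show fin: "AE z in lborel. gsup z < \<infinity>"
    using nn_integral_noteq_infinite[of gsup lborel] nn_integral_gsup by (auto simp: top.not_eq_extremum)
  show "integrable lborel (\<lambda>z. enn2real (gsup z))"
  proof (rule integrableI_bounded)
    have "(\<integral>\<^sup>+z. ennreal (norm (enn2real (gsup z))) \<partial>lborel) = (\<integral>\<^sup>+z. gsup z \<partial>lborel)"
      using fin by (intro nn_integral_cong_AE) (auto elim!: eventually_mono)
    then show "(\<integral>\<^sup>+z. ennreal (norm (enn2real (gsup z))) \<partial>lborel) < \<infinity>"
      using nn_integral_gsup by simp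
  qed simp
qed

lemma norm_grad_le_gsup: "gsup z < \<infinity> \<Longrightarrow> dist z x < \<epsilon> \<Longrightarrow> norm (grad rho x) \<le> enn2real (gsup z)"
proof -
  assume *: "gsup z < \<infinity>" "dist z x < \<epsilon>"
  then have "ennreal (norm (grad rho x)) \<le> gsup z"
    unfolding gsup_def by (intro SUP_upper) auto
  then show ?thesis using * by (metis enn2real_mono enn2real_ennreal norm_ge_zero infinity_ennreal_def)
qed

lemma integrable_norm_grad: "integrable lborel (\<lambda>z. norm (grad rho z))"
proof (rule Bochner_Integration.integrable_bound[OF integrable_gsup])
  show "AE z in lborel. norm (norm (grad rho z)) \<le> norm (enn2real (gsup z))"
    using gsup_finite by eventually_elim (use eps_pos in \<open>auto intro!: norm_grad_le_gsup\<close>)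
qed simp

lemma integrable_grad_inner: "integrable lborel (\<lambda>z. grad rho z \<bullet> w)"
  by (rule integrable_inner_left) (use integrable_norm_grad in \<open>simp add: integrable_norm_iff\<close>)

text \<open>First-order Taylor remainder of \<open>rho\<close> for the displacement
  \<open>- w\<close>: translating the argument of a test function by \<open>w\<close> translates the
  density the other way.\<close>

definition taylor_rem :: "real^'n \<Rightarrow> real^'n \<Rightarrow> real" where
  "taylor_rem w z = rho (z - w) - rho z + grad rho z \<bullet> w"

lemma taylor_rem_measurable [measurable]: "taylor_rem w \<in> borel_measurable borel"
  unfolding taylor_rem_def[abs_def] by measurable

text \<open>Provides the dominating function. The mean value inequality on the ball around
  \<open>z\<close> bounds the increment by \<open>gsup z\<close> times the norm of \<open>w\<close>,
  and the linear term obeys the same bound; hence the factor 2.\<close>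

lemma abs_taylor_rem_le:
  assumes "norm w < \<epsilon>" "gsup z < \<infinity>"
  shows "\<bar>taylor_rem w z\<bar> \<le> 2 * norm w * enn2real (gsup z)"
proof -
  let ?B = "enn2real (gsup z)"
  have "norm (rho (z - w) - rho z) \<le> ?B * norm ((z - w) - z)"
  proof (rule differentiable_bound[of "ball z \<epsilon>" rho "\<lambda>x h. h \<bullet> grad rho x"])
    show "(rho has_derivative (\<lambda>h. h \<bullet> grad rho x)) (at x within ball z \<epsilon>)" for x
      using gderiv_grad[OF differentiable[of x]] by (auto simp: gderiv_def intro: has_derivative_at_withinI)
    show "onorm (\<lambda>h. h \<bullet> grad rho x) \<le> ?B" if "x \<in> ball z \<epsilon>" for x
    proof (rule onorm_le)
      fix h :: "real^'n"
      have "norm (h \<bullet> grad rho x) \<le> norm h * norm (grad rho x)" by (simp add: Cauchy_Schwarz_ineq2)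
      also have "\<dots> \<le> norm h * ?B"
        using that assms by (intro mult_left_mono norm_grad_le_gsup) auto
      finally show "norm (h \<bullet> grad rho x) \<le> ?B * norm h" by (simp add: mult.commute)
    qed
  qed (use assms eps_pos in \<open>auto simp: dist_norm\<close>)
  moreover have "\<bar>grad rho z \<bullet> w\<bar> \<le> ?B * norm w"
  proof -
    have "\<bar>grad rho z \<bullet> w\<bar> \<le> norm (grad rho z) * norm w" by (rule Cauchy_Schwarz_ineq2)
    also have "\<dots> \<le> ?B * norm w"
      using assms eps_pos by (intro mult_right_mono norm_grad_le_gsup) auto
    finally show ?thesis .
  qed
  ultimately show ?thesis unfolding taylor_rem_def by (simp add: algebra_simps)
qed

lemma taylor_rem_tendsto:
  assumes w: "\<And>n. w n \<noteq> 0" "w \<longlonglongrightarrow> 0"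
  shows "(\<lambda>n. \<bar>taylor_rem (w n) z\<bar> / norm (w n)) \<longlonglongrightarrow> 0"
proof -
  have "(rho has_derivative (\<lambda>h. h \<bullet> grad rho z)) (at z)"
    using gderiv_grad[OF differentiable[of z]] by (simp add: gderiv_def)
  then have "((\<lambda>h. norm (rho (z + h) - rho z - h \<bullet> grad rho z) / norm h) \<longlongrightarrow> 0) (at 0)"
    by (simp add: has_derivative_at)
  moreover have "filterlim (\<lambda>n. - w n) (at 0) sequentially"
    using w tendsto_minus[OF w(2)] by (auto simp: filterlim_at)
  ultimately have "((\<lambda>n. norm (rho (z + - w n) - rho z - (- w n) \<bullet> grad rho z) / norm (- w n)) \<longlongrightarrow> 0) sequentially"
    by (rule filterlim_compose)
  then show ?thesis by (simp add: taylor_rem_def inner_commute)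
qed

text \<open>The limit is over vectors \<open>w\<close> tending to 0, not along rays, so one radius
  \<open>r\<close> serves all directions. This yields uniformity when \<open>w\<close> is the image
  of one displacement under all exponentials at times in \<open>[0, t]\<close>.\<close>

lemma integral_taylor_rem_small:
  assumes "0 < \<eta>"
  shows "\<exists>r>0. \<forall>w. norm w < r \<longrightarrow> (\<integral>z. \<bar>taylor_rem w z\<bar> \<partial>lborel) \<le> \<eta> * norm w"
proof -
  have "((\<lambda>w. (\<integral>z. \<bar>taylor_rem w z\<bar> / norm w \<partial>lborel)) \<longlongrightarrow> 0) (at 0)"
  proof (subst tendsto_at_iff_sequentially, intro allI impI)
    fix X :: "nat \<Rightarrow> real^'n" assume X: "\<forall>i. X i \<in> UNIV - {0}" "X \<longlonglongrightarrow> 0"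
    \<comment> \<open>The domination holds only for \<open>norm w < \<epsilon>\<close>; dropping the
      first \<open>k\<close> terms does not affect the limit.\<close>
    then obtain k where k: "\<And>i. i \<ge> k \<Longrightarrow> norm (X i) < \<epsilon>"
      using eps_pos unfolding lim_sequentially dist_0_norm dist_norm by (metis diff_zero)
    have "(\<lambda>i. \<integral>z. \<bar>taylor_rem (X (i + k)) z\<bar> / norm (X (i + k)) \<partial>lborel) \<longlonglongrightarrow> (\<integral>z. 0 \<partial>(lborel :: (real^'n) measure))"
    proof (rule integral_dominated_convergence[where w="\<lambda>z. 2 * enn2real (gsup z)"])
      show "integrable lborel (\<lambda>z. 2 * enn2real (gsup z))" using integrable_gsup by simp
      show "AE z in lborel. (\<lambda>i. \<bar>taylor_rem (X (i + k)) z\<bar> / norm (X (i + k))) \<longlonglongrightarrow> 0"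
        using X by (intro AE_I2 taylor_rem_tendsto LIMSEQ_ignore_initial_segment) auto
      show "AE z in lborel. norm (\<bar>taylor_rem (X (i + k)) z\<bar> / norm (X (i + k))) \<le> 2 * enn2real (gsup z)" for i
        using gsup_finite
      proof eventually_elim
        case (elim z)
        have "\<bar>taylor_rem (X (i + k)) z\<bar> \<le> 2 * norm (X (i + k)) * enn2real (gsup z)"
          using elim k by (intro abs_taylor_rem_le) auto
        then show ?case using X(1) by (simp add: divide_simps mult_ac)
      qed
    qed measurable
    then show "((\<lambda>w. \<integral>z. \<bar>taylor_rem w z\<bar> / norm w \<partial>lborel) \<circ> X) \<longlonglongrightarrow> 0"
      by (simp add: o_def LIMSEQ_offset)
  qed
  then obtain r where r: "r > 0" "\<And>w. w \<noteq> 0 \<Longrightarrow> norm w < r \<Longrightarrow> \<bar>\<integral>z. \<bar>taylor_rem w z\<bar> / norm w \<partial>lborel\<bar> < \<eta>"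
    using assms by (auto simp: LIM_eq)
  have "(\<integral>z. \<bar>taylor_rem w z\<bar> \<partial>lborel) \<le> \<eta> * norm w" if "norm w < r" for w
  proof (cases "w = 0")
    case True then show ?thesis by (simp add: taylor_rem_def)
  next
    case False
    then show ?thesis using r(2)[OF False that] by (simp add: divide_simps split: if_splits)
  qed
  then show ?thesis using r(1) by blast
qed

end

section \<open>Shifting independent jumps\<close>

lemma (in prob_space) indep_rv_distr:
  assumes "indep_rv M S X T Y"
  shows "distr M S X \<Otimes>\<^sub>M distr M T Y = distr M (S \<Otimes>\<^sub>M T) (\<lambda>\<omega>. (X \<omega>, Y \<omega>))"
proof -
  have X[measurable]: "X \<in> M \<rightarrow>\<^sub>M S" and Y[measurable]: "Y \<in> M \<rightarrow>\<^sub>M T" using assms by (auto simp: indep_rv_def)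
  interpret X: prob_space "distr M S X" by (rule prob_space_distr) simp
  interpret Y: prob_space "distr M T Y" by (rule prob_space_distr) simp
  show ?thesis
  proof (rule pair_measure_eqI)
    fix A B assume "A \<in> sets (distr M S X)" "B \<in> sets (distr M T Y)"
    then have [measurable]: "A \<in> sets S" "B \<in> sets T" by auto
    have "measure M {\<omega>\<in>space M. X \<omega> \<in> A \<and> Y \<omega> \<in> B} =
        measure M {\<omega>\<in>space M. X \<omega> \<in> A} * measure M {\<omega>\<in>space M. Y \<omega> \<in> B}"
      using assms by (auto simp: indep_rv_def)
    then show "emeasure (distr M S X) A * emeasure (distr M T Y) B =
        emeasure (distr M (S \<Otimes>\<^sub>M T) (\<lambda>\<omega>. (X \<omega>, Y \<omega>))) (A \<times> B)"
      by (simp add: emeasure_distr emeasure_eq_measure vimage_def Int_def conj_commute ennreal_mult')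
  qed (simp_all add: X.sigma_finite_measure_axioms Y.sigma_finite_measure_axioms)
qed

lemma (in prob_space) indep_rv_nn_integral:
  assumes "indep_rv M S X T Y" and [measurable]: "\<psi> \<in> borel_measurable (S \<Otimes>\<^sub>M T)"
  shows "(\<integral>\<^sup>+\<omega>. \<psi> (X \<omega>, Y \<omega>) \<partial>M) = (\<integral>\<^sup>+\<omega>. \<integral>\<^sup>+\<omega>'. \<psi> (X \<omega>, Y \<omega>') \<partial>M \<partial>M)"
proof -
  have X[measurable]: "X \<in> M \<rightarrow>\<^sub>M S" and Y[measurable]: "Y \<in> M \<rightarrow>\<^sub>M T" using assms by (auto simp: indep_rv_def)
  interpret Y: prob_space "distr M T Y" by (rule prob_space_distr) simp
  have "(\<integral>\<^sup>+\<omega>. \<psi> (X \<omega>, Y \<omega>) \<partial>M) = (\<integral>\<^sup>+p. \<psi> p \<partial>distr M (S \<Otimes>\<^sub>M T) (\<lambda>\<omega>. (X \<omega>, Y \<omega>)))"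
    by (subst nn_integral_distr) auto
  also have "\<dots> = (\<integral>\<^sup>+p. \<psi> p \<partial>(distr M S X \<Otimes>\<^sub>M distr M T Y))"
    by (simp add: indep_rv_distr[OF assms(1)])
  also have "\<dots> = (\<integral>\<^sup>+x. \<integral>\<^sup>+y. \<psi> (x, y) \<partial>distr M T Y \<partial>distr M S X)"
    by (rule Y.nn_integral_fst[symmetric]) simp
  also have "\<dots> = (\<integral>\<^sup>+\<omega>. \<integral>\<^sup>+y. \<psi> (X \<omega>, y) \<partial>distr M T Y \<partial>M)"
    by (subst nn_integral_distr) auto
  also have "\<dots> = (\<integral>\<^sup>+\<omega>. \<integral>\<^sup>+\<omega>'. \<psi> (X \<omega>, Y \<omega>') \<partial>M \<partial>M)"
    by (intro nn_integral_cong nn_integral_distr) (auto dest: measurable_space[OF X])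
  finally show ?thesis .
qed

text \<open>Fubini with \<open>X\<close> frozen. The hypothesis bounds the absolute value of the
  inner mean and not the mean of the absolute value, so cancellation in the average over
  \<open>Y\<close> survives.\<close>

lemma (in prob_space) indep_rv_integral_bound:
  fixes \<psi> :: "_ \<Rightarrow> real"
  assumes indep: "indep_rv M S X T Y" and [measurable]: "\<psi> \<in> borel_measurable (S \<Otimes>\<^sub>M T)"
    and int: "integrable M (\<lambda>\<omega>. \<psi> (X \<omega>, Y \<omega>))"
    and bound: "AE \<omega> in M. \<bar>\<integral>\<omega>'. \<psi> (X \<omega>, Y \<omega>') \<partial>M\<bar> \<le> B"
  shows "\<bar>\<integral>\<omega>. \<psi> (X \<omega>, Y \<omega>) \<partial>M\<bar> \<le> B"
proof -
  have X[measurable]: "X \<in> M \<rightarrow>\<^sub>M S" and Y[measurable]: "Y \<in> M \<rightarrow>\<^sub>M T" using assms by (auto simp: indep_rv_def)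
  interpret X: prob_space "distr M S X" by (rule prob_space_distr) simp
  interpret Y: prob_space "distr M T Y" by (rule prob_space_distr) simp
  interpret XY: pair_sigma_finite "distr M S X" "distr M T Y" by standard
  have int': "integrable (distr M S X \<Otimes>\<^sub>M distr M T Y) \<psi>"
    using int by (simp add: indep_rv_distr[OF indep] integrable_distr_eq)
  have "(\<integral>\<omega>. \<psi> (X \<omega>, Y \<omega>) \<partial>M) = (\<integral>p. \<psi> p \<partial>distr M (S \<Otimes>\<^sub>M T) (\<lambda>\<omega>. (X \<omega>, Y \<omega>)))"
    by (subst integral_distr) auto
  also have "\<dots> = (\<integral>p. \<psi> p \<partial>(distr M S X \<Otimes>\<^sub>M distr M T Y))"
    by (simp add: indep_rv_distr[OF indep])
  also have "\<dots> = (\<integral>x. \<integral>y. \<psi> (x, y) \<partial>distr M T Y \<partial>distr M S X)"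
    by (rule XY.integral_fst'[OF int', symmetric])
  also have "\<dots> = (\<integral>\<omega>. \<integral>y. \<psi> (X \<omega>, y) \<partial>distr M T Y \<partial>M)"
    by (subst integral_distr) auto
  finally have eq: "(\<integral>\<omega>. \<psi> (X \<omega>, Y \<omega>) \<partial>M) = (\<integral>\<omega>. \<integral>y. \<psi> (X \<omega>, y) \<partial>distr M T Y \<partial>M)" .
  have *: "AE \<omega> in M. \<bar>\<integral>y. \<psi> (X \<omega>, y) \<partial>distr M T Y\<bar> \<le> B"
    using bound
  proof (eventually_elim)
    case (elim \<omega>)
    show ?case
    proof (cases "(\<lambda>y. \<psi> (X \<omega>, y)) \<in> borel_measurable T")
      case True
      then show ?thesis using elim by (subst integral_distr) auto
    next
      \<comment> \<open>Membership of \<open>\<omega>\<close> in the space of \<open>M\<close> is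
        not at hand here, so the section may fail to be measurable; its integral is then 0 by
        convention, and \<open>elim\<close> forces \<open>0 \<le> B\<close>.\<close>
      case False
      then have "\<not> integrable (distr M T Y) (\<lambda>y. \<psi> (X \<omega>, y))" by (auto dest: borel_measurable_integrable)
      then show ?thesis using elim by (simp add: not_integrable_integral_eq)
    qed
  qed
  have "\<bar>\<integral>\<omega>. \<integral>y. \<psi> (X \<omega>, y) \<partial>distr M T Y \<partial>M\<bar> \<le> (\<integral>\<omega>. \<bar>\<integral>y. \<psi> (X \<omega>, y) \<partial>distr M T Y\<bar> \<partial>M)"
    by (rule integral_abs_bound)
  also have "\<dots> \<le> (\<integral>\<omega>. B \<partial>M)"
  proof (rule integral_mono_AE)
    show "integrable M (\<lambda>\<omega>. \<bar>\<integral>y. \<psi> (X \<omega>, y) \<partial>distr M T Y\<bar>)"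
      using * by (intro integrable_const_bound[where B=B]) auto
  qed (use * in auto)
  finally show ?thesis by (simp add: eq prob_space)
qed

lemma (in prob_space) indep_var_imp_indep_rv: 
  assumes "indep_var S X T Y" shows "indep_rv M S X T Y"
  unfolding indep_rv_def
proof (intro conjI ballI)
  show "X \<in> M \<rightarrow>\<^sub>M S" "Y \<in> M \<rightarrow>\<^sub>M T" using assms by (auto dest: indep_var_rv1 indep_var_rv2)
  fix A B assume "A \<in> sets S" "B \<in> sets T"
  from indep_varD[OF assms this]
  show "prob {\<omega> \<in> space M. X \<omega> \<in> A \<and> Y \<omega> \<in> B} = prob {\<omega> \<in> space M. X \<omega> \<in> A} * prob {\<omega> \<in> space M. Y \<omega> \<in> B}"
    by (simp add: vimage_def Int_def conj_commute)
qed

section \<open>Translations absorbed by the density of a jump\<close>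

lemma lborel_integral_shift:
  fixes g :: "'a::euclidean_space \<Rightarrow> real"
  assumes [measurable]: "g \<in> borel_measurable borel"
  shows "(\<integral>z. g (z + w) \<partial>lborel) = (\<integral>z. g z \<partial>lborel)"
proof -
  have "(\<integral>z. g z \<partial>lborel) = (\<integral>z. g z \<partial>distr lborel borel ((+) w))" by (simp add: lborel_distr_plus)
  then show ?thesis by (simp add: integral_distr add.commute)
qed

locale levy_density = smooth_density_grad rho \<epsilon> for rho :: "real^'n \<Rightarrow> real" and \<epsilon> +
  fixes lam :: real
  assumes lam_pos: "0 < lam"
    and lam_eq: "(\<integral>\<^sup>+z. ennreal (rho z) \<partial>lborel) = ennreal lam"
begin

lemma integrable_rho: "integrable lborel rho"
  by (rule integrableI_nonneg) (auto simp: nonneg lam_eq)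

text \<open>The density \<open>rho / lam\<close> cancels the denominator of the score, leaving the
  norm of \<open>grad rho\<close>.\<close>

lemma nn_integral_norm_score:
  assumes "distributed M lborel X (\<lambda>z. ennreal (rho z / lam))"
  shows "(\<integral>\<^sup>+\<omega>. ennreal (norm (score (X \<omega>))) \<partial>M) = ennreal ((\<integral>z. norm (grad rho z) \<partial>lborel) / lam)"
proof -
  have "(\<integral>\<^sup>+\<omega>. ennreal (norm (score (X \<omega>))) \<partial>M) = (\<integral>\<^sup>+z. ennreal (rho z / lam) * ennreal (norm (score z)) \<partial>lborel)"
    by (rule distributed_nn_integral[OF assms, symmetric]) simp
  also have "\<dots> = (\<integral>\<^sup>+z. ennreal (norm (grad rho z) / lam) \<partial>lborel)"
    using nonneg lam_pos
    by (intro nn_integral_cong) (simp add: rho_score[symmetric] ennreal_mult'[symmetric])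
  also have "\<dots> = ennreal (\<integral>z. norm (grad rho z) / lam \<partial>lborel)"
    using integrable_norm_grad lam_pos by (intro nn_integral_eq_integral) auto
  finally show ?thesis by simp
qed

lemma integrable_score:
  assumes "distributed M lborel X (\<lambda>z. ennreal (rho z / lam))"
  shows "integrable M (\<lambda>\<omega>. score (X \<omega>))"
proof (rule integrableI_bounded)
  have [measurable]: "X \<in> M \<rightarrow>\<^sub>M borel" using assms by (auto simp: distributed_def)
  show "(\<lambda>\<omega>. score (X \<omega>)) \<in> borel_measurable M" by measurable
  show "(\<integral>\<^sup>+\<omega>. ennreal (norm (score (X \<omega>))) \<partial>M) < \<infinity>" by (simp add: nn_integral_norm_score[OF assms])
qed

text \<open>After the shift is moved from \<open>f\<close> to the density, the three terms combine
  into the integral of \<open>f\<close> against \<open>taylor_rem w\<close>; boundedness of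
  \<open>f\<close> finishes.\<close>

lemma integral_shift_bound:
  fixes f :: "real^'n \<Rightarrow> real"
  assumes X: "distributed M lborel X (\<lambda>z. ennreal (rho z / lam))"
    and [measurable]: "f \<in> borel_measurable borel" and f: "\<And>z. \<bar>f z\<bar> \<le> K"
  shows "\<bar>\<integral>\<omega>. f (X \<omega> + w) - f (X \<omega>) + f (X \<omega>) * (score (X \<omega>) \<bullet> w) \<partial>M\<bar> \<le> K / lam * (\<integral>z. \<bar>taylor_rem w z\<bar> \<partial>lborel)"
proof -
  have bdd: "integrable lborel (\<lambda>z. f (h z) * g z)" if "integrable lborel g" and [measurable]: "h \<in> borel_measurable borel"
    for g h
  proof (rule Bochner_Integration.integrable_bound[of lborel "\<lambda>z. K * g z"])
    show "AE z in lborel. norm (f (h z) * g z) \<le> norm (K * g z)"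
    proof (intro AE_I2)
      fix z show "norm (f (h z) * g z) \<le> norm (K * g z)"
        using f[of "h z"] by (auto simp: abs_mult intro!: mult_right_mono)
    qed
  qed (use that in auto)
  have int_shift: "integrable lborel (\<lambda>z. rho (z - w))"
  proof -
    have "integrable (distr lborel borel ((+) (- w))) rho" using integrable_rho by (simp add: lborel_distr_plus)
    then show ?thesis by (subst (asm) integrable_distr_eq) auto
  qed
  have "(\<integral>\<omega>. f (X \<omega> + w) - f (X \<omega>) + f (X \<omega>) * (score (X \<omega>) \<bullet> w) \<partial>M)
     = (\<integral>z. (rho z / lam) * (f (z + w) - f z + f z * (score z \<bullet> w)) \<partial>lborel)"
    using nonneg lam_pos by (intro distributed_integral[OF X, symmetric]) auto
  also have "\<dots> = (\<integral>z. (f (z + w) * rho z - f z * rho z + f z * (grad rho z \<bullet> w)) / lam \<partial>lborel)"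
    by (intro Bochner_Integration.integral_cong refl) (simp add: rho_score[symmetric] field_simps)
  also have "\<dots> = ((\<integral>z. f (z + w) * rho z \<partial>lborel) - (\<integral>z. f z * rho z \<partial>lborel) + (\<integral>z. f z * (grad rho z \<bullet> w) \<partial>lborel)) / lam"
    using bdd[OF integrable_rho, of "\<lambda>z. z + w"] bdd[OF integrable_rho, of "\<lambda>z. z"]
      bdd[OF integrable_grad_inner, of "\<lambda>z. z" w] by simp
  \<comment> \<open>Translation invariance of Lebesgue measure takes the shift off \<open>f\<close>,
    so no regularity of \<open>f\<close> enters.\<close>
  also have "(\<integral>z. f (z + w) * rho z \<partial>lborel) = (\<integral>z. f z * rho (z - w) \<partial>lborel)"
    using lborel_integral_shift[of "\<lambda>z. f z * rho (z - w)" w] by simp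
  also have "((\<integral>z. f z * rho (z - w) \<partial>lborel) - (\<integral>z. f z * rho z \<partial>lborel) + (\<integral>z. f z * (grad rho z \<bullet> w) \<partial>lborel))
     = (\<integral>z. f z * taylor_rem w z \<partial>lborel)"
    using bdd[OF int_shift, of "\<lambda>z. z"] bdd[OF integrable_rho, of "\<lambda>z. z"]
      bdd[OF integrable_grad_inner, of "\<lambda>z. z" w] by (simp add: taylor_rem_def algebra_simps)
  finally have eq: "(\<integral>\<omega>. f (X \<omega> + w) - f (X \<omega>) + f (X \<omega>) * (score (X \<omega>) \<bullet> w) \<partial>M) = (\<integral>z. f z * taylor_rem w z \<partial>lborel) / lam" .
  have int_rem: "integrable lborel (taylor_rem w)"
    unfolding taylor_rem_def[abs_def] using int_shift integrable_rho integrable_grad_inner by simp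
  have "\<bar>\<integral>z. f z * taylor_rem w z \<partial>lborel\<bar> \<le> (\<integral>z. \<bar>f z * taylor_rem w z\<bar> \<partial>lborel)"
    by (rule integral_abs_bound)
  also have "\<dots> \<le> (\<integral>z. K * \<bar>taylor_rem w z\<bar> \<partial>lborel)"
  proof (rule integral_mono)
    show "\<bar>f z * taylor_rem w z\<bar> \<le> K * \<bar>taylor_rem w z\<bar>" for z
      using f[of z] by (auto simp: abs_mult intro!: mult_right_mono)
  qed (use bdd[OF int_rem, of "\<lambda>z. z"] int_rem in auto)
  finally show ?thesis using lam_pos by (simp add: eq divide_right_mono)
qed

text \<open>With \<open>U\<close> frozen at \<open>u\<close>, the map sending \<open>z\<close> to
  \<open>f (u + B *v z)\<close> is again measurable and bounded by \<open>K\<close>, and the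
  displacement \<open>B *v w\<close> outside is a displacement \<open>w\<close> of
  \<open>X\<close>.\<close>

lemma indep_shift_bound:
  fixes f :: "real^'n \<Rightarrow> real" and B :: "real^'n^'n"
  assumes prob: "prob_space M" and indep: "indep_rv M borel U borel X"
    and X: "distributed M lborel X (\<lambda>z. ennreal (rho z / lam))"
    and [measurable]: "f \<in> borel_measurable borel" and f: "\<And>z. \<bar>f z\<bar> \<le> K"
  shows "integrable M (\<lambda>\<omega>. f (U \<omega> + B *v X \<omega> + B *v w) - f (U \<omega> + B *v X \<omega>) + f (U \<omega> + B *v X \<omega>) * (score (X \<omega>) \<bullet> w))"
    and "\<bar>\<integral>\<omega>. f (U \<omega> + B *v X \<omega> + B *v w) - f (U \<omega> + B *v X \<omega>) + f (U \<omega> + B *v X \<omega>) * (score (X \<omega>) \<bullet> w) \<partial>M\<bar>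
      \<le> K / lam * (\<integral>z. \<bar>taylor_rem w z\<bar> \<partial>lborel)"
proof -
  interpret prob_space M by (rule prob)
  have [measurable]: "U \<in> borel_measurable M" "X \<in> borel_measurable M" using indep by (auto simp: indep_rv_def)
  have [measurable]: "(\<lambda>z. B *v z) \<in> borel_measurable borel"
    by (intro borel_measurable_continuous_onI linear_continuous_on matrix_vector_mul_bounded_linear)
  define \<psi> where "\<psi> = (\<lambda>(u, x). f (u + B *v x + B *v w) - f (u + B *v x) + f (u + B *v x) * (score x \<bullet> w))"
  have [measurable]: "\<psi> \<in> borel_measurable (borel \<Otimes>\<^sub>M borel)" unfolding \<psi>_def by measurable
  have K: "0 \<le> K" using f[of 0] by linarith
  have int: "integrable M (\<lambda>\<omega>. \<psi> (U \<omega>, X \<omega>))"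
  proof (rule Bochner_Integration.integrable_bound)
    show "integrable M (\<lambda>\<omega>. 2 * K + K * \<bar>score (X \<omega>) \<bullet> w\<bar>)"
      using integrable_score[OF X] by auto
    show "AE \<omega> in M. norm (\<psi> (U \<omega>, X \<omega>)) \<le> norm (2 * K + K * \<bar>score (X \<omega>) \<bullet> w\<bar>)"
    proof (intro AE_I2)
      fix \<omega>
      let ?a = "f (U \<omega> + B *v X \<omega> + B *v w)" and ?b = "f (U \<omega> + B *v X \<omega>)" and ?s = "score (X \<omega>) \<bullet> w"
      have "\<bar>?b * ?s\<bar> \<le> K * \<bar>?s\<bar>" using f by (auto simp: abs_mult intro!: mult_right_mono)
      moreover have "\<bar>?a\<bar> \<le> K" "\<bar>?b\<bar> \<le> K" using f by auto
      ultimately show "norm (\<psi> (U \<omega>, X \<omega>)) \<le> norm (2 * K + K * \<bar>?s\<bar>)"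
        unfolding \<psi>_def by simp
    qed
  qed measurable
  then show "integrable M (\<lambda>\<omega>. f (U \<omega> + B *v X \<omega> + B *v w) - f (U \<omega> + B *v X \<omega>) + f (U \<omega> + B *v X \<omega>) * (score (X \<omega>) \<bullet> w))"
    by (simp add: \<psi>_def)
  have "\<bar>\<integral>\<omega>'. \<psi> (u, X \<omega>') \<partial>M\<bar> \<le> K / lam * (\<integral>z. \<bar>taylor_rem w z\<bar> \<partial>lborel)" for u
    using integral_shift_bound[OF X, of "\<lambda>z. f (u + B *v z)" K w] f
    by (simp add: \<psi>_def matrix_vector_right_distrib add.assoc)
  then have "\<bar>\<integral>\<omega>. \<psi> (U \<omega>, X \<omega>) \<partial>M\<bar> \<le> K / lam * (\<integral>z. \<bar>taylor_rem w z\<bar> \<partial>lborel)"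
    by (intro indep_rv_integral_bound[OF indep] int) auto
  then show "\<bar>\<integral>\<omega>. f (U \<omega> + B *v X \<omega> + B *v w) - f (U \<omega> + B *v X \<omega>) + f (U \<omega> + B *v X \<omega>) * (score (X \<omega>) \<bullet> w) \<partial>M\<bar>
      \<le> K / lam * (\<integral>z. \<bar>taylor_rem w z\<bar> \<partial>lborel)"
    by (simp add: \<psi>_def)
qed

text \<open>The same displacement \<open>c\<close> can be charged to any summand \<open>i\<close>,
  with \<open>w i\<close> as displacement of \<open>X i\<close> and the other summands in the role
  of \<open>U\<close>. The difference of \<open>f\<close> values does not depend on
  \<open>i\<close>, so averaging the estimates leaves it intact and averages only the score
  terms.\<close>

lemma average_shift_bound:
  fixes f :: "real^'n \<Rightarrow> real" and B :: "'i \<Rightarrow> real^'n^'n"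
  assumes prob: "prob_space M" and indep: "prob_space.indep_vars M (\<lambda>_. borel) X J"
    and I: "finite I" "I \<noteq> {}" "I \<subseteq> J"
    and X: "\<And>i. i \<in> I \<Longrightarrow> distributed M lborel (X i) (\<lambda>z. ennreal (rho z / lam))"
    and [measurable]: "f \<in> borel_measurable borel" and f: "\<And>z. \<bar>f z\<bar> \<le> K"
    and w: "\<And>i. i \<in> I \<Longrightarrow> B i *v w i = c"
    and D: "\<And>i. i \<in> I \<Longrightarrow> (\<integral>z. \<bar>taylor_rem (w i) z\<bar> \<partial>lborel) \<le> D"
  shows "\<bar>\<integral>\<omega>. f (y + (\<Sum>i\<in>I. B i *v X i \<omega>) + c) - f (y + (\<Sum>i\<in>I. B i *v X i \<omega>))
      + f (y + (\<Sum>i\<in>I. B i *v X i \<omega>)) * ((1 / real (card I)) * (\<Sum>i\<in>I. score (X i \<omega>) \<bullet> w i)) \<partial>M\<bar> \<le> K / lam * D"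
proof -
  interpret prob_space M by (rule prob)
  define S where "S \<omega> = y + (\<Sum>i\<in>I. B i *v X i \<omega>)" for \<omega>
  define G where "G i \<omega> = f (S \<omega> + c) - f (S \<omega>) + f (S \<omega>) * (score (X i \<omega>) \<bullet> w i)" for i \<omega>
  have K: "0 \<le> K" using f[of 0] by linarith
  have G: "integrable M (G i) \<and> \<bar>\<integral>\<omega>. G i \<omega> \<partial>M\<bar> \<le> K / lam * D" if i: "i \<in> I" for i
  proof -
    define U where "U \<omega> = y + (\<Sum>j\<in>I - {i}. B j *v X j \<omega>)" for \<omega>
    have [measurable]: "(\<lambda>z. B j *v z) \<in> borel_measurable borel" for j
      by (intro borel_measurable_continuous_onI linear_continuous_on matrix_vector_mul_bounded_linear)
    \<comment> \<open>Independence of the sum over the other indices from \<open>X i\<close>,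
      obtained by grouping the family over the disjoint index sets \<open>I - {i}\<close> and
      \<open>{i}\<close>.\<close>
    have "indep_var borel ((\<lambda>x. y + (\<Sum>j\<in>I - {i}. B j *v x j)) \<circ> (\<lambda>\<omega>. restrict (\<lambda>i. X i \<omega>) (I - {i})))
        borel ((\<lambda>x. x i) \<circ> (\<lambda>\<omega>. restrict (\<lambda>i. X i \<omega>) {i}))"
      using I i by (intro indep_var_compose[OF indep_var_restrict[OF indep]]) auto
    moreover have "(\<lambda>x. y + (\<Sum>j\<in>I - {i}. B j *v x j)) \<circ> (\<lambda>\<omega>. restrict (\<lambda>i. X i \<omega>) (I - {i})) = U"
      by (auto simp: U_def fun_eq_iff)
    moreover have "(\<lambda>x. x i) \<circ> (\<lambda>\<omega>. restrict (\<lambda>i. X i \<omega>) {i}) = X i" by auto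
    ultimately have ind: "indep_rv M borel U borel (X i)" by (auto intro: indep_var_imp_indep_rv)
    have S: "S \<omega> = U \<omega> + B i *v X i \<omega>" for \<omega>
      using I i by (simp add: S_def U_def sum.remove[of I i] add_ac)
    have "K / lam * (\<integral>z. \<bar>taylor_rem (w i) z\<bar> \<partial>lborel) \<le> K / lam * D"
      using D[OF i] K lam_pos by (intro mult_left_mono) auto
    then show ?thesis
      using indep_shift_bound[OF prob ind X[OF i] \<open>f \<in> borel_measurable borel\<close> f, of "B i" "w i"] w[OF i]
      unfolding G_def[abs_def] S by force
  qed
  have "f (S \<omega> + c) - f (S \<omega>) + f (S \<omega>) * ((1 / real (card I)) * (\<Sum>i\<in>I. score (X i \<omega>) \<bullet> w i))
     = (\<Sum>i\<in>I. G i \<omega>) / real (card I)" for \<omega>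
    using I by (simp add: G_def sum.distrib sum_subtractf sum_distrib_left[symmetric] add_divide_distrib diff_divide_distrib)
  then have "\<bar>\<integral>\<omega>. f (S \<omega> + c) - f (S \<omega>) + f (S \<omega>) * ((1 / real (card I)) * (\<Sum>i\<in>I. score (X i \<omega>) \<bullet> w i)) \<partial>M\<bar>
     = \<bar>\<Sum>i\<in>I. \<integral>\<omega>. G i \<omega> \<partial>M\<bar> / real (card I)"
    using G by (simp add: abs_divide)
  also have "\<dots> \<le> (\<Sum>i\<in>I. K / lam * D) / real (card I)"
    using G by (intro divide_right_mono order_trans[OF sum_abs] sum_mono) auto
  also have "\<dots> = K / lam * D" using I by simp
  finally show ?thesis by (simp add: S_def)
qed

end

section \<open>Cadlag paths and step paths\<close>

text \<open>One-sided limits bound the path near every point, and bounds on adjacent intervals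
  combine; the bisection principle turns this into a bound on the whole compact interval.\<close>

lemma cadlag_bounded:
  fixes g :: "real \<Rightarrow> 'a::real_normed_vector"
  assumes g: "cadlag g" and "0 \<le> t"
  shows "\<exists>B. \<forall>s\<in>{0..t}. norm (g s) \<le> B"
proof -
  have "\<exists>B. \<forall>s\<in>{0..t}. 0 \<le> s \<longrightarrow> norm (g s) \<le> B"
  proof (rule Bolzano[where P="\<lambda>a b. \<exists>B. \<forall>s\<in>{a..b}. 0 \<le> s \<longrightarrow> norm (g s) \<le> B"])
    show "0 \<le> t" by fact
    show "\<exists>B. \<forall>s\<in>{a..c}. 0 \<le> s \<longrightarrow> norm (g s) \<le> B"
      if ab: "\<exists>B. \<forall>s\<in>{a..b}. 0 \<le> s \<longrightarrow> norm (g s) \<le> B" and bc: "\<exists>B. \<forall>s\<in>{b..c}. 0 \<le> s \<longrightarrow> norm (g s) \<le> B" for a b c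
    proof -
      obtain B1 B2 where "\<forall>s\<in>{a..b}. 0 \<le> s \<longrightarrow> norm (g s) \<le> B1" "\<forall>s\<in>{b..c}. 0 \<le> s \<longrightarrow> norm (g s) \<le> B2"
        using ab bc by blast
      then show ?thesis by (intro exI[of _ "max B1 B2"]) (fastforce simp: le_max_iff_disj)
    qed
    fix x :: real assume x: "0 \<le> x" "x \<le> t"
    have "(g \<longlongrightarrow> g x) (at_right x)" using g x by (auto simp: cadlag_def continuous_within)
    then have "\<forall>\<^sub>F r in at_right x. dist (g r) (g x) < 1" by (rule tendstoD) simp
    then obtain b where b: "b > x" "\<And>r. x < r \<Longrightarrow> r < b \<Longrightarrow> norm (g r) \<le> norm (g x) + 1"
      by (auto simp: eventually_at_right_field dist_norm) (smt (verit) norm_triangle_sub)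
    obtain a C where a: "a < x" "\<And>r. 0 \<le> r \<Longrightarrow> a < r \<Longrightarrow> r < x \<Longrightarrow> norm (g r) \<le> C"
    \<comment> \<open>At 0 no left limit is assumed, but the guard \<open>0 \<le> r\<close> leaves
      nothing to bound on that side.\<close>
    proof (cases "x = 0")
      case True
      then show ?thesis using that[of "-1" 0] by auto
    next
      case False
      then have "0 < x" using x by simp
      then obtain l where "(g \<longlongrightarrow> l) (at_left x)" using g unfolding cadlag_def by blast
      then have "\<forall>\<^sub>F r in at_left x. dist (g r) l < 1" by (rule tendstoD) simp
      then obtain a where "a < x" "\<And>r. a < r \<Longrightarrow> r < x \<Longrightarrow> norm (g r) \<le> norm l + 1"
        by (auto simp: eventually_at_left_field dist_norm) (smt (verit) norm_triangle_sub)
      then show ?thesis using that by blast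
    qed
    have *: "norm (g r) \<le> max (norm (g x) + 1) C" if "0 \<le> r" "a < r" "r < b" for r
    proof (cases r x rule: linorder_cases)
      case less then show ?thesis using a(2)[of r] that by auto
    next
      case greater then show ?thesis using b(2)[of r] that by auto
    qed auto
    show "\<exists>d>0. \<forall>u v. u \<le> x \<and> x \<le> v \<and> v - u < d \<longrightarrow> (\<exists>B. \<forall>s\<in>{u..v}. 0 \<le> s \<longrightarrow> norm (g s) \<le> B)"
    proof (rule exI[of _ "min (b - x) (x - a)"], intro conjI allI impI)
      show "0 < min (b - x) (x - a)" using a b by simp
      fix u v :: real assume "u \<le> x \<and> x \<le> v \<and> v - u < min (b - x) (x - a)"
      then show "\<exists>B. \<forall>s\<in>{u..v}. 0 \<le> s \<longrightarrow> norm (g s) \<le> B"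
        by (intro exI[of _ "max (norm (g x) + 1) C"] ballI impI) (rule *; auto)
    qed
  qed
  then show ?thesis by auto
qed

lemma cadlag_diff:
  fixes g h :: "real \<Rightarrow> 'a::real_normed_vector"
  shows "cadlag g \<Longrightarrow> cadlag h \<Longrightarrow> cadlag (\<lambda>s. g s - h s)"
  unfolding cadlag_def by (blast intro: continuous_diff tendsto_diff)

text \<open>Right continuity makes the process the pointwise limit of its samples at grid points
  just to the right of the current time; a sample uses countably many times and so is jointly
  measurable. \<open>max 0\<close> confines time to the half-line on which right continuity is
  assumed.\<close>

lemma cadlag_joint_measurable:
  fixes Z :: "real \<Rightarrow> 'w \<Rightarrow> 'a::euclidean_space"
  assumes Z: "\<And>s. 0 \<le> s \<Longrightarrow> Z s \<in> borel_measurable F" and cad: "\<And>\<omega>. \<omega> \<in> space F \<Longrightarrow> cadlag (\<lambda>s. Z s \<omega>)"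
  shows "(\<lambda>p. Z (max 0 (fst p)) (snd p)) \<in> borel_measurable (borel \<Otimes>\<^sub>M F)"
proof (rule borel_measurable_LIMSEQ_metric)
  \<comment> \<open>Adding 1 after the floor puts the sampling time strictly to the right even at a
    grid point, as convergence along \<open>at_right\<close> demands.\<close>
  let ?q = "\<lambda>n (s::real). (of_int \<lfloor>real (Suc n) * max 0 s\<rfloor> + 1) / real (Suc n)"
  show "(\<lambda>p. Z (?q n (fst p)) (snd p)) \<in> borel_measurable (borel \<Otimes>\<^sub>M F)" for n
  proof -
    have "(\<lambda>p. Z (max 0 ((of_int \<lfloor>real (Suc n) * max 0 (fst p)\<rfloor> + 1) / real (Suc n))) (snd p)) \<in> borel_measurable (borel \<Otimes>\<^sub>M F)"
    proof (rule measurable_compose_countable[where f="\<lambda>i p. Z (max 0 ((of_int i + 1) / real (Suc n))) (snd p)"])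
      show "(\<lambda>p. Z (max 0 ((real_of_int i + 1) / real (Suc n))) (snd p)) \<in> borel_measurable (borel \<Otimes>\<^sub>M F)" for i
        by (rule measurable_compose[OF measurable_snd Z]) simp
    qed measurable
    also have "(\<lambda>p. Z (max 0 ((of_int \<lfloor>real (Suc n) * max 0 (fst p)\<rfloor> + 1) / real (Suc n))) (snd p))
       = (\<lambda>p. Z (?q n (fst p)) (snd p))"
    proof
      fix p :: "real \<times> 'w"
      have "0 \<le> ?q n (fst p)" by (intro divide_nonneg_nonneg add_nonneg_nonneg) auto
      then show "Z (max 0 (?q n (fst p))) (snd p) = Z (?q n (fst p)) (snd p)" by (simp add: max_def)
    qed
    finally show ?thesis .
  qed
  fix p :: "real \<times> 'w" assume p: "p \<in> space (borel \<Otimes>\<^sub>M F)"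
  let ?s = "max 0 (fst p)"
  have lo: "?s < ?q n (fst p)" for n
  proof -
    have "real (Suc n) * ?s < of_int \<lfloor>real (Suc n) * ?s\<rfloor> + 1" by linarith
    then show ?thesis by (simp only: pos_less_divide_eq of_nat_0_less_iff zero_less_Suc mult.commute)
  qed
  have hi: "?q n (fst p) \<le> ?s + 1 / real (Suc n)" for n
  proof -
    have "of_int \<lfloor>real (Suc n) * ?s\<rfloor> \<le> real (Suc n) * ?s" by linarith
    then have "?q n (fst p) \<le> (real (Suc n) * ?s + 1) / real (Suc n)" by (intro divide_right_mono add_right_mono) auto
    also have "\<dots> = ?s + 1 / real (Suc n)" by (simp only: add_divide_distrib nonzero_mult_div_cancel_left of_nat_eq_0_iff nat.simps simp_thms)
    finally show ?thesis .
  qed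
  have "(\<lambda>n. ?q n (fst p)) \<longlonglongrightarrow> ?s"
  proof (rule tendsto_sandwich)
    show "\<forall>\<^sub>F n in sequentially. ?s \<le> ?q n (fst p)" by (intro always_eventually allI less_imp_le lo)
    show "\<forall>\<^sub>F n in sequentially. ?q n (fst p) \<le> ?s + 1 / real (Suc n)" by (intro always_eventually allI hi)
    show "(\<lambda>n. ?s + 1 / real (Suc n)) \<longlonglongrightarrow> ?s"
      using tendsto_add[OF tendsto_const LIMSEQ_Suc[OF lim_1_over_n[where 'a=real]], of ?s] by simp
  qed (rule tendsto_const)
  then have "filterlim (\<lambda>n. ?q n (fst p)) (at_right ?s) sequentially"
    unfolding filterlim_at
    using lo not_sym[OF less_imp_neq[OF lo]] by (intro conjI always_eventually allI) (simp_all only: greaterThan_iff simp_thms)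
  moreover have "((\<lambda>s. Z s (snd p)) \<longlongrightarrow> Z ?s (snd p)) (at_right ?s)"
    using cad[of "snd p"] p by (auto simp: cadlag_def continuous_within space_pair_measure)
  ultimately show "(\<lambda>n. Z (?q n (fst p)) (snd p)) \<longlonglongrightarrow> Z ?s (snd p)"
    by (rule filterlim_compose[rotated])
qed

lemma mexp_mult_measurable:
  "(\<lambda>p. mexp ((t - fst p) *\<^sub>R A) *v (A *v snd p)) \<in> borel_measurable (borel \<Otimes>\<^sub>M borel)"
proof -
  have "continuous_on UNIV (\<lambda>p. mexp ((t - fst p) *\<^sub>R A) *v (A *v snd p))"
    by (intro bounded_bilinear.continuous_on[OF bounded_bilinear_matrix_vector_mult]
        continuous_on_compose2[OF continuous_on_mexp[of UNIV]] linear_continuous_on_compose[of _ snd "\<lambda>x. A *v x"]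
        continuous_intros) auto
  then show ?thesis by (simp add: borel_prod borel_measurable_continuous_onI)
qed

lemma cadlag_ou_set_integrable:
  fixes A :: "real^'n^'n" and g :: "real \<Rightarrow> real^'n"
  assumes g: "cadlag g" and "0 \<le> t"
  shows "set_integrable lborel {0..t} (\<lambda>s. mexp ((t - s) *\<^sub>R A) *v (A *v g s))"
proof -
  obtain \<theta> where \<theta>: "\<And>v. v \<bullet> (A *v v) \<le> - \<theta> * (norm v)\<^sup>2" using dissipative_ex[of A] by blast
  obtain K where K: "K > 0" "\<And>v. norm (A *v v) \<le> norm v * K"
    using bounded_linear.pos_bounded[OF matrix_vector_mul_bounded_linear[of A]] by blast
  obtain B where B: "\<And>s. s \<in> {0..t} \<Longrightarrow> norm (g s) \<le> B" using cadlag_bounded[OF assms] by blast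
  \<comment> \<open>A single path is a process over a one-point space, which makes its measurability
    a case of the joint statement.\<close>
  have "(\<lambda>p. g (max 0 (fst p))) \<in> borel_measurable (borel \<Otimes>\<^sub>M count_space (UNIV :: unit set))"
    by (rule cadlag_joint_measurable[of "\<lambda>s _. g s"]) (auto simp: g)
  then have [measurable]: "(\<lambda>s. g (max 0 s)) \<in> borel_measurable borel"
    using measurable_compose[OF measurable_Pair2', of "()" "count_space UNIV"  "\<lambda>p. g (max 0 (fst p))" borel borel] by simp
  have "set_integrable lborel {0..t} (\<lambda>s. mexp ((t - s) *\<^sub>R A) *v (A *v g (max 0 s)))"
    unfolding set_integrable_def
  proof (rule Bochner_Integration.integrable_bound)
    show "integrable lborel (\<lambda>s. indicator {0..t} s *\<^sub>R (exp (max (- \<theta>) 0 * t) * (B * K)))"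
      by (intro integrable_scaleR_left) (simp add: integrable_indicator_iff emeasure_lborel_Icc_eq)
    show "(\<lambda>s. indicator {0..t} s *\<^sub>R (mexp ((t - s) *\<^sub>R A) *v (A *v g (max 0 s)))) \<in> borel_measurable lborel"
    proof -
      have "(\<lambda>s. (s, g (max 0 s))) \<in> borel \<rightarrow>\<^sub>M borel \<Otimes>\<^sub>M borel" by measurable
      from measurable_compose[OF this mexp_mult_measurable[of t A]]
      have [measurable]: "(\<lambda>s. mexp ((t - s) *\<^sub>R A) *v (A *v g (max 0 s))) \<in> borel_measurable borel" by simp
      show ?thesis by measurable
    qed
    show "AE s in lborel. norm (indicator {0..t} s *\<^sub>R (mexp ((t - s) *\<^sub>R A) *v (A *v g (max 0 s))))
      \<le> norm (indicator {0..t} s *\<^sub>R (exp (max (- \<theta>) 0 * t) * (B * K)))"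
    proof (intro AE_I2)
      fix s
      show "norm (indicator {0..t} s *\<^sub>R (mexp ((t - s) *\<^sub>R A) *v (A *v g (max 0 s))))
        \<le> norm (indicator {0..t} s *\<^sub>R (exp (max (- \<theta>) 0 * t) * (B * K)))"
      proof (cases "s \<in> {0..t}")
        case True
        have "norm (mexp ((t - s) *\<^sub>R A) *v (A *v g s)) \<le> exp (max (- \<theta>) 0 * t) * norm (A *v g s)"
          using True by (intro norm_mexp_le[OF \<theta>]) auto
        also have "\<dots> \<le> exp (max (- \<theta>) 0 * t) * (B * K)"
          using K B[OF True] by (intro mult_left_mono order_trans[OF K(2)] mult_right_mono) auto
        finally show ?thesis using True by (simp add: max_def)
      qed simp
    qed
  qed
  then show ?thesis
    by (rule set_integrable_cong[THEN iffD1, rotated -1]) (auto simp: max_def)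
qed

lemma cadlag_ou_integrable:
  "cadlag g \<Longrightarrow> 0 \<le> t \<Longrightarrow> (\<lambda>s. mexp ((t - s) *\<^sub>R A) *v (A *v g s)) integrable_on {0..t}"
  by (rule set_borel_integral_eq_integral) (rule cadlag_ou_set_integrable)

text \<open>On cadlag paths the gauge integral in \<open>ou_int\<close> is a Lebesgue integral, and
  joint measurability in time and outcome then gives measurability in the outcome. \<open>F\<close>
  is arbitrary because both \<open>M\<close> and the sigma-algebra generated by the path of
  \<open>L1\<close> are to be inserted.\<close>

lemma borel_measurable_ou_int:
  fixes A :: "real^'n^'n" and Z :: "real \<Rightarrow> 'w \<Rightarrow> real^'n"
  assumes Z: "\<And>s. 0 \<le> s \<Longrightarrow> Z s \<in> borel_measurable F" and cad: "\<And>\<omega>. \<omega> \<in> space F \<Longrightarrow> cadlag (\<lambda>s. Z s \<omega>)"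
    and "0 \<le> t"
  shows "ou_int A Z t \<in> borel_measurable F"
proof -
  note [measurable] = cadlag_joint_measurable[OF Z cad]
  let ?I = "\<lambda>\<omega>. \<integral>s. indicator {0..t} s *\<^sub>R (mexp ((t - s) *\<^sub>R A) *v (A *v Z (max 0 s) \<omega>)) \<partial>lborel"
  have "?I \<in> borel_measurable F"
  proof (rule sigma_finite_measure.borel_measurable_lebesgue_integral)
    have "(\<lambda>p. (fst p, Z (max 0 (fst p)) (snd p))) \<in> borel \<Otimes>\<^sub>M F \<rightarrow>\<^sub>M borel \<Otimes>\<^sub>M borel" by measurable
    from measurable_compose[OF this mexp_mult_measurable[of t A]]
    have [measurable]: "(\<lambda>p. mexp ((t - fst p) *\<^sub>R A) *v (A *v Z (max 0 (fst p)) (snd p))) \<in> borel_measurable (borel \<Otimes>\<^sub>M F)"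
      by simp
    have "(\<lambda>(\<omega>, s). (s, \<omega>)) \<in> F \<Otimes>\<^sub>M lborel \<rightarrow>\<^sub>M borel \<Otimes>\<^sub>M F" by measurable
    from measurable_compose[OF this, of "\<lambda>p. indicator {0..t} (fst p) *\<^sub>R (mexp ((t - fst p) *\<^sub>R A) *v (A *v Z (max 0 (fst p)) (snd p)))" borel]
    show "(\<lambda>(\<omega>, s). indicator {0..t} s *\<^sub>R (mexp ((t - s) *\<^sub>R A) *v (A *v Z (max 0 s) \<omega>))) \<in> borel_measurable (F \<Otimes>\<^sub>M lborel)"
      by (simp add: split_beta')
  qed (rule sigma_finite_lborel)
  moreover have "ou_int A Z t \<omega> = Z t \<omega> + ?I \<omega>" if "\<omega> \<in> space F" for \<omega>
  proof -
    have "integral {0..t} (\<lambda>s. mexp ((t - s) *\<^sub>R A) *v (A *v Z s \<omega>)) = (LINT s:{0..t}|lborel. mexp ((t - s) *\<^sub>R A) *v (A *v Z s \<omega>))"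
      by (rule set_borel_integral_eq_integral(2)[symmetric])
         (rule cadlag_ou_set_integrable[OF cad[OF that] \<open>0 \<le> t\<close>])
    also have "\<dots> = ?I \<omega>"
      unfolding set_lebesgue_integral_def
      by (intro Bochner_Integration.integral_cong refl) (auto simp: indicator_def max_def)
    finally show ?thesis by (simp add: ou_int_def)
  qed
  ultimately show ?thesis using Z[OF \<open>0 \<le> t\<close>]
    by (subst measurable_cong[where g="\<lambda>\<omega>. Z t \<omega> + ?I \<omega>"]) auto
qed

text \<open>Superposition of single jumps; the endpoint value \<open>l t\<close> restores the terms
  \<open>z i\<close> that the integrals subtract.\<close>

lemma ou_step:
  fixes A :: "real^'n^'n" and l :: "real \<Rightarrow> real^'n"
  assumes I: "finite I" and \<tau>: "\<And>i. i \<in> I \<Longrightarrow> 0 < \<tau> i \<and> \<tau> i \<le> t" and "0 \<le> t"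
    and l: "\<And>s. 0 \<le> s \<Longrightarrow> s \<le> t \<Longrightarrow> l s = (\<Sum>i\<in>I. if \<tau> i \<le> s then z i else 0)"
  shows "l t + integral {0..t} (\<lambda>s. mexp ((t - s) *\<^sub>R A) *v (A *v l s)) = (\<Sum>i\<in>I. mexp ((t - \<tau> i) *\<^sub>R A) *v z i)"
proof -
  have "((\<lambda>s. \<Sum>i\<in>I. if \<tau> i \<le> s then mexp ((t - s) *\<^sub>R A) *v (A *v z i) else 0) has_integral
     (\<Sum>i\<in>I. mexp ((t - \<tau> i) *\<^sub>R A) *v z i - z i)) {0..t}"
    using \<tau> I by (intro has_integral_sum has_integral_mexp_step) (auto intro: less_imp_le)
  moreover have "(\<Sum>i\<in>I. if \<tau> i \<le> s then mexp ((t - s) *\<^sub>R A) *v (A *v z i) else 0) = mexp ((t - s) *\<^sub>R A) *v (A *v l s)"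
    if "s \<in> {0..t}" for s
    using that by (auto simp: l linear_sum[OF matrix_vector_mul_linear] intro!: sum.cong)
  ultimately have "((\<lambda>s. mexp ((t - s) *\<^sub>R A) *v (A *v l s)) has_integral
     (\<Sum>i\<in>I. mexp ((t - \<tau> i) *\<^sub>R A) *v z i - z i)) {0..t}"
    by (rule has_integral_eq[rotated]) auto
  moreover have "l t = (\<Sum>i\<in>I. z i)" using \<tau> \<open>0 \<le> t\<close> by (auto simp: l intro!: sum.cong)
  ultimately show ?thesis by (simp add: integral_unique sum_subtractf)
qed

text \<open>The test for a vanishing increment discards cells without a jump, since
  \<open>g b 0\<close> need not be 0; a summand that counts jumps, for instance, equals 1
  there.\<close>

definition grid_sum :: "(real \<Rightarrow> 'a \<Rightarrow> 'b::comm_monoid_add) \<Rightarrow> real \<Rightarrow> nat \<Rightarrow> (real \<Rightarrow> 'a::ab_group_add) \<Rightarrow> 'b" where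
  "grid_sum g t m l = (\<Sum>k<Suc m. let a = t * real k / real (Suc m); b = t * real (Suc k) / real (Suc m) in
      if l b - l a = 0 then 0 else g b (l b - l a))"

text \<open>The marks of a step path are read off from its increments over a grid finer than the
  distances between the jump times.\<close>

lemma grid_sum_tendsto:
  fixes l :: "real \<Rightarrow> 'a::ab_group_add" and g :: "real \<Rightarrow> 'a \<Rightarrow> 'b::real_normed_vector"
  assumes I: "finite I" and \<tau>: "\<And>i. i \<in> I \<Longrightarrow> 0 < \<tau> i \<and> \<tau> i \<le> t" and inj: "inj_on \<tau> I" and t: "0 < t"
    and l: "\<And>s. 0 \<le> s \<Longrightarrow> s \<le> t \<Longrightarrow> l s = (\<Sum>i\<in>I. if \<tau> i \<le> s then z i else 0)"
    and z: "\<And>i. i \<in> I \<Longrightarrow> z i \<noteq> 0"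
    and g: "\<And>z. continuous_on UNIV (\<lambda>s. g s z)"
  shows "(\<lambda>m. grid_sum g t m l) \<longlonglongrightarrow> (\<Sum>i\<in>I. g (\<tau> i) (z i))"
proof -
  define s where "s m k = t * real k / real (Suc m)" for m k
  \<comment> \<open>Index of the grid cell, open on the left and closed on the right, that contains
    \<open>\<tau> i\<close>. Positivity of \<open>\<tau> i\<close> makes the ceiling at least 1, so
    the natural subtraction is exact.\<close>
  define \<kappa> where "\<kappa> m i = nat \<lceil>\<tau> i * real (Suc m) / t\<rceil> - 1" for m i
  have Suc_\<kappa>: "real (Suc (\<kappa> m i)) = of_int \<lceil>\<tau> i * real (Suc m) / t\<rceil>" if "i \<in> I" for m i
  proof -
    have "0 < \<tau> i * real (Suc m) / t" using \<tau>[OF that] t by simp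
    then have "1 \<le> \<lceil>\<tau> i * real (Suc m) / t\<rceil>" by simp
    then show ?thesis unfolding \<kappa>_def by linarith
  qed
  have \<kappa>_iff: "s m k < \<tau> i \<and> \<tau> i \<le> s m (Suc k) \<longleftrightarrow> \<kappa> m i = k" if i: "i \<in> I" for m k i
  proof -
    have "s m k < \<tau> i \<longleftrightarrow> real k < \<tau> i * real (Suc m) / t"
      using t unfolding s_def by (simp add: field_simps)
    moreover have "\<tau> i \<le> s m (Suc k) \<longleftrightarrow> \<tau> i * real (Suc m) / t \<le> real (Suc k)"
      using t unfolding s_def by (simp add: field_simps)
    moreover have "real k < \<tau> i * real (Suc m) / t \<and> \<tau> i * real (Suc m) / t \<le> real (Suc k)
      \<longleftrightarrow> \<lceil>\<tau> i * real (Suc m) / t\<rceil> = int (Suc k)"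
      by (simp add: ceiling_eq_iff)
    ultimately show ?thesis using Suc_\<kappa>[OF i, of m] by linarith
  qed
  have \<kappa>_less: "\<kappa> m i < Suc m" if "i \<in> I" for m i
  proof -
    have "\<tau> i * real (Suc m) / t \<le> real (Suc m)" using \<tau>[OF that] t by (simp add: divide_le_eq)
    then have "\<lceil>\<tau> i * real (Suc m) / t\<rceil> \<le> int (Suc m)" by (simp add: ceiling_le_iff)
    then show ?thesis using Suc_\<kappa>[OF that, of m] by linarith
  qed
  have bounds: "s m (\<kappa> m i) < \<tau> i" "\<tau> i \<le> s m (Suc (\<kappa> m i))" if "i \<in> I" for m i
    using \<kappa>_iff[OF that, of m "\<kappa> m i"] by auto
  have s_Suc: "s m (Suc k) = s m k + t / real (Suc m)" for m k
    unfolding s_def by (simp add: add_divide_distrib distrib_left)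
  have mesh: "(\<lambda>m. t / real (Suc m)) \<longlonglongrightarrow> 0"
    using tendsto_mult[OF tendsto_const[of t] LIMSEQ_Suc[OF lim_1_over_n[where 'a=real]]] by simp
  have "\<forall>\<^sub>F m in sequentially. \<forall>i\<in>I. \<forall>j\<in>I. i \<noteq> j \<longrightarrow> t / real (Suc m) < \<bar>\<tau> i - \<tau> j\<bar>"
  proof (intro eventually_ball_finite I ballI)
    fix i j assume "i \<in> I" "j \<in> I"
    show "\<forall>\<^sub>F m in sequentially. i \<noteq> j \<longrightarrow> t / real (Suc m) < \<bar>\<tau> i - \<tau> j\<bar>"
    proof (cases "i = j")
      case False
      then have "0 < \<bar>\<tau> i - \<tau> j\<bar>" using inj \<open>i \<in> I\<close> \<open>j \<in> I\<close> by (auto dest: inj_onD)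
      from order_tendstoD(2)[OF mesh this] show ?thesis by eventually_elim simp
    qed simp
  qed
  then have "\<forall>\<^sub>F m in sequentially. grid_sum g t m l = (\<Sum>i\<in>I. g (s m (Suc (\<kappa> m i))) (z i))"
  proof eventually_elim
    case (elim m)
    have inj_\<kappa>: "inj_on (\<kappa> m) I"
    proof (rule inj_onI, rule ccontr)
      fix i j assume ij: "i \<in> I" "j \<in> I" "\<kappa> m i = \<kappa> m j" "i \<noteq> j"
      then have "\<bar>\<tau> i - \<tau> j\<bar> \<le> t / real (Suc m)"
        using bounds[of i m] bounds[of j m] s_Suc[of m "\<kappa> m i"] by auto
      then show False using elim ij by force
    qed
    have incr: "l (s m (Suc k)) - l (s m k) = (\<Sum>i\<in>I. if \<kappa> m i = k then z i else 0)" if "k < Suc m" for k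
    proof -
      have "0 \<le> s m k" "s m k \<le> s m (Suc k)" "s m (Suc k) \<le> t"
        using t that unfolding s_def by (auto simp: field_simps)
      then have "l (s m (Suc k)) - l (s m k) = (\<Sum>i\<in>I. (if \<tau> i \<le> s m (Suc k) then z i else 0) - (if \<tau> i \<le> s m k then z i else 0))"
        by (simp add: l sum_subtractf)
      also have "\<dots> = (\<Sum>i\<in>I. if \<kappa> m i = k then z i else 0)"
        using \<open>s m k \<le> s m (Suc k)\<close> by (intro sum.cong refl) (auto simp flip: \<kappa>_iff)
      finally show ?thesis .
    qed
    have incr1: "l (s m (Suc (\<kappa> m i))) - l (s m (\<kappa> m i)) = z i" if "i \<in> I" for i
    proof -
      have "(\<Sum>j\<in>I. if \<kappa> m j = \<kappa> m i then z j else 0) = (\<Sum>j\<in>I. if j = i then z j else 0)"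
        using inj_\<kappa> that by (intro sum.cong refl) (auto dest: inj_onD)
      then show ?thesis using that I by (simp add: incr[OF \<kappa>_less])
    qed
    have incr0: "l (s m (Suc k)) - l (s m k) = 0" if "k < Suc m" "k \<notin> \<kappa> m ` I" for k
      using that by (subst incr) (auto intro!: sum.neutral)
    let ?F = "\<lambda>k. if l (s m (Suc k)) - l (s m k) = 0 then 0 else g (s m (Suc k)) (l (s m (Suc k)) - l (s m k))"
    have "grid_sum g t m l = (\<Sum>k<Suc m. ?F k)" unfolding grid_sum_def s_def Let_def ..
    also have "\<dots> = (\<Sum>k\<in>\<kappa> m ` I. ?F k)"
      using \<kappa>_less incr0 by (intro sum.mono_neutral_right) auto
    also have "\<dots> = (\<Sum>i\<in>I. ?F (\<kappa> m i))" by (simp add: sum.reindex[OF inj_\<kappa>])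
    also have "\<dots> = (\<Sum>i\<in>I. g (s m (Suc (\<kappa> m i))) (z i))"
      using z by (intro sum.cong refl) (simp add: incr1)
    finally show ?case .
  qed
  \<comment> \<open>The marks are already exact for large \<open>m\<close> and only the evaluation
    times still move, so continuity of \<open>g\<close> in the time argument is all that is
    used.\<close>
  moreover have "(\<lambda>m. \<Sum>i\<in>I. g (s m (Suc (\<kappa> m i))) (z i)) \<longlonglongrightarrow> (\<Sum>i\<in>I. g (\<tau> i) (z i))"
  proof (rule tendsto_sum)
    fix i assume i: "i \<in> I"
    have "(\<lambda>m. s m (Suc (\<kappa> m i))) \<longlonglongrightarrow> \<tau> i"
    proof (rule tendsto_sandwich)
      show "\<forall>\<^sub>F m in sequentially. \<tau> i \<le> s m (Suc (\<kappa> m i))" using bounds[OF i] by simp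
      show "\<forall>\<^sub>F m in sequentially. s m (Suc (\<kappa> m i)) \<le> \<tau> i + t / real (Suc m)"
        using bounds[OF i] s_Suc by (intro always_eventually allI) (auto intro: less_imp_le)
      show "(\<lambda>m. \<tau> i + t / real (Suc m)) \<longlonglongrightarrow> \<tau> i" using tendsto_add[OF tendsto_const mesh, of "\<tau> i"] by simp
    qed simp
    moreover have "isCont (\<lambda>s. g s (z i)) (\<tau> i)" using g[of "z i"] by (simp add: continuous_on_eq_continuous_at)
    ultimately show "(\<lambda>m. g (s m (Suc (\<kappa> m i))) (z i)) \<longlonglongrightarrow> g (\<tau> i) (z i)"
      by (rule isCont_tendsto_compose[rotated])
  qed
  ultimately show ?thesis by (simp add: tendsto_cong)
qed

section \<open>Jump times and reconstruction from the compound Poisson path\<close>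

lemma jump_time_measurable [measurable (raw)]:
  "(\<And>j. E j \<in> borel_measurable F) \<Longrightarrow> jump_time E i \<in> borel_measurable F"
  unfolding jump_time_def[abs_def] by measurable

lemma count_proc_measurable [measurable (raw)]:
  assumes [measurable]: "\<And>j. E j \<in> borel_measurable F"
  shows "count_proc E t \<in> F \<rightarrow>\<^sub>M count_space UNIV"
  unfolding count_proc_def[abs_def] by measurable

text \<open>Integral of \<open>g\<close> against the marked point process up to time
  \<open>t\<close>. Interarrival times and marks are separate arguments, so that the same functional
  can be evaluated on a product space of sequences.\<close>

definition mark_sum :: "(real \<Rightarrow> 'a \<Rightarrow> 'b::comm_monoid_add) \<Rightarrow> (nat \<Rightarrow> 'w \<Rightarrow> real) \<Rightarrow> (nat \<Rightarrow> 'w \<Rightarrow> 'a) \<Rightarrow> real \<Rightarrow> 'w \<Rightarrow> 'b" where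
  "mark_sum g E X t \<omega> = (\<Sum>i\<in>{1..count_proc E t \<omega>}. g (jump_time E i \<omega>) (X i \<omega>))"

lemma mark_sum_measurable:
  fixes g :: "real \<Rightarrow> 'a::second_countable_topology \<Rightarrow> 'b::{second_countable_topology, topological_comm_monoid_add}"
  assumes [measurable]: "\<And>j. E j \<in> borel_measurable F" and X[measurable]: "\<And>i. 1 \<le> i \<Longrightarrow> X i \<in> borel_measurable F"
    and g[measurable]: "(\<lambda>p. g (fst p) (snd p)) \<in> borel_measurable (borel \<Otimes>\<^sub>M borel)"
  shows "mark_sum g E X t \<in> borel_measurable F"
  unfolding mark_sum_def[abs_def]
proof (rule measurable_compose_countable[where g="count_proc E t" and f="\<lambda>n \<omega>. \<Sum>i\<in>{1..n}. g (jump_time E i \<omega>) (X i \<omega>)"])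
  show "(\<lambda>\<omega>. \<Sum>i\<in>{1..n}. g (jump_time E i \<omega>) (X i \<omega>)) \<in> borel_measurable F" for n
  proof (rule borel_measurable_sum)
    fix i assume "i \<in> {1..n}"
    then have "(\<lambda>\<omega>. (jump_time E i \<omega>, X i \<omega>)) \<in> F \<rightarrow>\<^sub>M borel \<Otimes>\<^sub>M borel" by (intro measurable_Pair X jump_time_measurable) auto
    from measurable_compose[OF this g] show "(\<lambda>\<omega>. g (jump_time E i \<omega>) (X i \<omega>)) \<in> borel_measurable F" by simp
  qed
qed measurable

lemma jump_time_strict_mono:
  assumes "\<And>j. 0 < E j \<omega>" shows "strict_mono (\<lambda>i. jump_time E i \<omega>)"
  using assms by (intro strict_monoI_Suc) (simp add: jump_time_def)

text \<open>\<open>count_proc\<close> is a \<open>card\<close>, which is 0 for infinite sets, so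
  finiteness has to be shown. One interarrival time longer than \<open>t\<close> is enough: it
  pushes all later jumps beyond \<open>t\<close>.\<close>

lemma jump_times_upto:
  assumes pos: "\<And>j. 0 < E j \<omega>" and large: "t < E j \<omega>" and "s \<le> t"
  shows "{i. 1 \<le> i \<and> jump_time E i \<omega> \<le> s} = {1..count_proc E s \<omega>}"
proof -
  let ?S = "{i. 1 \<le> i \<and> jump_time E i \<omega> \<le> s}"
  have mono: "jump_time E i \<omega> \<le> jump_time E k \<omega>" if "i \<le> k" for i k
    using monoD[OF strict_mono_mono[OF jump_time_strict_mono[of E \<omega>, OF pos]] that] .
  have "jump_time E (Suc j) \<omega> > t"
    using large mono[of 0 j] by (simp add: jump_time_def)
  then have "i \<le> j" if "i \<in> ?S" for i
    using mono[of "Suc j" i] that \<open>s \<le> t\<close> by (cases "Suc j \<le> i") auto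
  then have "?S \<subseteq> {..j}" by blast
  then have fin: "finite ?S" by (rule finite_subset) simp
  show ?thesis
  proof (cases "?S = {}")
    case True
    then show ?thesis unfolding count_proc_def True by simp
  next
    case False
    define m where "m = Max ?S"
    have "m \<in> ?S" unfolding m_def using fin False by (rule Max_in)
    moreover have "i \<le> m" if "i \<in> ?S" for i unfolding m_def using fin that by (rule Max_ge)
    ultimately have "?S = {1..m}" using mono[of _ m] by (fastforce intro: order_trans[of _ "jump_time E m \<omega>"])
    then show ?thesis unfolding count_proc_def by simp
  qed
qed

lemma compound_poisson_eq_step:
  assumes pos: "\<And>j. 0 < E j \<omega>" and large: "t < E j \<omega>" and "s \<le> t"
  shows "compound_poisson E \<xi> s \<omega> = (\<Sum>i\<in>{1..count_proc E t \<omega>}. if jump_time E i \<omega> \<le> s then \<xi> i \<omega> else 0)"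
proof -
  have "{1..count_proc E s \<omega>} = {i \<in> {1..count_proc E t \<omega>}. jump_time E i \<omega> \<le> s}"
    using \<open>s \<le> t\<close> unfolding jump_times_upto[of E \<omega>, OF pos large order_refl, symmetric]
      jump_times_upto[of E \<omega>, OF pos large \<open>s \<le> t\<close>, symmetric] by auto
  then show ?thesis unfolding compound_poisson_def by (simp only: sum.inter_filter finite_atLeastAtMost)
qed

lemma jump_time_bounds:
  assumes pos: "\<And>j. 0 < E j \<omega>" and large: "t < E j \<omega>" and "i \<in> {1..count_proc E t \<omega>}"
  shows "0 < jump_time E i \<omega>" "jump_time E i \<omega> \<le> t"
proof -
  have "i \<in> {i. 1 \<le> i \<and> jump_time E i \<omega> \<le> t}"
    using assms(3) unfolding jump_times_upto[of E \<omega>, OF pos large order_refl, symmetric] .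
  moreover have "jump_time E 0 \<omega> < jump_time E i \<omega>" if "1 \<le> i"
    using strict_monoD[OF jump_time_strict_mono[of E \<omega>, OF pos], of 0 i] that by simp
  ultimately show "0 < jump_time E i \<omega>" "jump_time E i \<omega> \<le> t" by (auto simp: jump_time_def)
qed

text \<open>Events of \<open>U\<close> and \<open>V'\<close> are preimages of events of
  \<open>X\<close> and \<open>Z\<close>, for which the product rule is given. \<open>V\<close> is
  only required to agree with \<open>V'\<close> almost surely, as reconstruction from a path may
  fail on a null set.\<close>

lemma (in prob_space) indep_rv_vimage_algebra:
  assumes indep: "indep_rv M S X T Z"
    and U: "U \<in> vimage_algebra (space M) X S \<rightarrow>\<^sub>M S'" and V': "V' \<in> vimage_algebra (space M) Z T \<rightarrow>\<^sub>M T'"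
    and V: "V \<in> M \<rightarrow>\<^sub>M T'" and eq: "AE \<omega> in M. V \<omega> = V' \<omega>"
  shows "indep_rv M S' U T' V"
proof -
  have X[measurable]: "X \<in> M \<rightarrow>\<^sub>M S" and Z[measurable]: "Z \<in> M \<rightarrow>\<^sub>M T" using indep by (auto simp: indep_rv_def)
  have sX: "sets (vimage_algebra (space M) X S) = {X -` A \<inter> space M | A. A \<in> sets S}"
    using measurable_space[OF X] by (intro sets_vimage_algebra2) auto
  have sZ: "sets (vimage_algebra (space M) Z T) = {Z -` A \<inter> space M | A. A \<in> sets T}"
    using measurable_space[OF Z] by (intro sets_vimage_algebra2) auto
  have UM[measurable]: "U \<in> M \<rightarrow>\<^sub>M S'"
  proof (rule measurableI)
    show "U x \<in> space S'" if "x \<in> space M" for x using measurable_space[OF U] that by simp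
    show "U -` A \<inter> space M \<in> sets M" if "A \<in> sets S'" for A
      using measurable_sets[OF U that] by (auto simp: sX intro: measurable_sets[OF X])
  qed
  have V'M[measurable]: "V' \<in> M \<rightarrow>\<^sub>M T'"
  proof (rule measurableI)
    show "V' x \<in> space T'" if "x \<in> space M" for x using measurable_space[OF V'] that by simp
    show "V' -` A \<inter> space M \<in> sets M" if "A \<in> sets T'" for A
      using measurable_sets[OF V' that] by (auto simp: sZ intro: measurable_sets[OF Z])
  qed
  note V[measurable]
  show ?thesis unfolding indep_rv_def
  proof (intro conjI ballI UM V)
    fix A B assume A[measurable]: "A \<in> sets S'" and B[measurable]: "B \<in> sets T'"
    obtain A' where A': "A' \<in> sets S" "U -` A \<inter> space M = X -` A' \<inter> space M"
      using measurable_sets[OF U A] by (auto simp: sX)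
    obtain B' where B': "B' \<in> sets T" "V' -` B \<inter> space M = Z -` B' \<inter> space M"
      using measurable_sets[OF V' B] by (auto simp: sZ)
    have A'': "U \<omega> \<in> A \<longleftrightarrow> X \<omega> \<in> A'" if "\<omega> \<in> space M" for \<omega> using A'(2) that by blast
    have B'': "V' \<omega> \<in> B \<longleftrightarrow> Z \<omega> \<in> B'" if "\<omega> \<in> space M" for \<omega> using B'(2) that by blast
    have "prob {\<omega> \<in> space M. U \<omega> \<in> A \<and> V \<omega> \<in> B} = prob {\<omega> \<in> space M. U \<omega> \<in> A \<and> V' \<omega> \<in> B}"
      using eq by (intro measure_eq_AE) auto
    also have "\<dots> = prob {\<omega> \<in> space M. X \<omega> \<in> A' \<and> Z \<omega> \<in> B'}"
      using A'' B'' by (intro arg_cong[where f=prob]) auto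
    also have "\<dots> = prob {\<omega> \<in> space M. X \<omega> \<in> A'} * prob {\<omega> \<in> space M. Z \<omega> \<in> B'}"
      using indep A'(1) B'(1) by (auto simp: indep_rv_def)
    also have "prob {\<omega> \<in> space M. X \<omega> \<in> A'} = prob {\<omega> \<in> space M. U \<omega> \<in> A}"
      using A'' by (intro arg_cong[where f=prob]) auto
    also have "prob {\<omega> \<in> space M. Z \<omega> \<in> B'} = prob {\<omega> \<in> space M. V' \<omega> \<in> B}"
      using B'' by (intro arg_cong[where f=prob]) auto
    also have "\<dots> = prob {\<omega> \<in> space M. V \<omega> \<in> B}"
      using eq by (intro measure_eq_AE) auto
    finally show "prob {\<omega> \<in> space M. U \<omega> \<in> A \<and> V \<omega> \<in> B} = prob {\<omega> \<in> space M. U \<omega> \<in> A} * prob {\<omega> \<in> space M. V \<omega> \<in> B}" .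
  qed
qed

section \<open>Almost sure properties of the times and marks\<close>

locale jump_process = prob_space M + levy_density rho \<epsilon> lam
  for M :: "'w measure" and rho :: "real^'n \<Rightarrow> real" and \<epsilon> lam +
  fixes E :: "nat \<Rightarrow> 'w \<Rightarrow> real" and \<xi> :: "nat \<Rightarrow> 'w \<Rightarrow> real^'n"
  assumes E_indep: "indep_vars (\<lambda>_. borel) E UNIV"
    and E_exp: "\<And>j. distributed M lborel (E j) (\<lambda>s. ennreal (exponential_density lam s))"
    and xi_indep: "indep_vars (\<lambda>_. borel) \<xi> {1..}"
    and xi_distr: "\<And>i. 1 \<le> i \<Longrightarrow> distributed M lborel (\<xi> i) (\<lambda>z. ennreal (rho z / lam))"
    and xi_E_indep: "indep_rv M
        (Pi\<^sub>M UNIV (\<lambda>_. borel)) (\<lambda>\<omega> j. E j \<omega>)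
        (Pi\<^sub>M {1..} (\<lambda>_. borel)) (\<lambda>\<omega>. restrict (\<lambda>i. \<xi> i \<omega>) {1..})"
begin

lemma E_measurable [measurable]: "E j \<in> borel_measurable M"
  using E_exp[of j] by (auto simp: distributed_def)

lemma xi_measurable: "1 \<le> i \<Longrightarrow> \<xi> i \<in> borel_measurable M"
  using xi_distr[of i] by (auto simp: distributed_def)

lemma prob_E_le: "0 \<le> a \<Longrightarrow> prob {\<omega>\<in>space M. E j \<omega> \<le> a} = 1 - exp (- a * lam)"
  using exponential_distributedD_le[OF E_exp _ lam_pos] by simp

lemma AE_E_pos: "AE \<omega> in M. \<forall>j. 0 < E j \<omega>"
proof (subst AE_all_countable, rule allI)
  fix j
  have "prob {\<omega>\<in>space M. E j \<omega> \<le> 0} = 0" using prob_E_le[of 0 j] by simp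
  then have "AE \<omega> in M. \<not> E j \<omega> \<le> 0"
    by (subst (asm) measure_eq_0_null_sets[symmetric]) (auto simp: prob_eq_0)
  then show "AE \<omega> in M. 0 < E j \<omega>" by eventually_elim simp
qed

text \<open>The first \<open>n + 1\<close> interarrival times are all at most \<open>t\<close> with
  probability the \<open>(n + 1)\<close>-st power of a number below 1, which tends to 0.\<close>

lemma AE_E_large:
  assumes "0 \<le> t" shows "AE \<omega> in M. \<exists>j. t < E j \<omega>"
proof -
  let ?p = "1 - exp (- t * lam)"
  have p: "0 \<le> ?p" "?p < 1" using assms lam_pos by auto
  have le: "prob {\<omega>\<in>space M. \<forall>j. E j \<omega> \<le> t} \<le> ?p ^ Suc n" for n
  proof -
    have "prob {\<omega>\<in>space M. \<forall>j. E j \<omega> \<le> t} \<le> prob (\<Inter>j\<in>{..n}. E j -` {..t} \<inter> space M)"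
      by (intro finite_measure_mono) auto
    also have "\<dots> = (\<Prod>j\<in>{..n}. prob (E j -` {..t} \<inter> space M))"
      by (intro indep_varsD_finite[OF indep_vars_subset[OF E_indep]]) auto
    also have "\<dots> = ?p ^ Suc n"
      using prob_E_le[OF assms] by (simp add: vimage_def Int_def conj_commute)
    finally show ?thesis .
  qed
  have "(\<lambda>n. ?p ^ Suc n) \<longlonglongrightarrow> 0" using p by (intro LIMSEQ_Suc LIMSEQ_power_zero) auto
  then have "prob {\<omega>\<in>space M. \<forall>j. E j \<omega> \<le> t} \<le> 0"
    by (rule LIMSEQ_le_const) (use le in blast)
  then have "prob {\<omega>\<in>space M. \<forall>j. E j \<omega> \<le> t} = 0" by (simp add: measure_le_0_iff)
  then have "AE \<omega> in M. \<not> (\<forall>j. E j \<omega> \<le> t)"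
    by (subst (asm) prob_eq_0) auto
  then show ?thesis by eventually_elim (auto simp: not_le)
qed

text \<open>The law of a mark has a density, so the origin is null. A zero mark would leave no trace
  in the path.\<close>

lemma AE_xi_nonzero: "AE \<omega> in M. \<forall>i\<in>{1..}. \<xi> i \<omega> \<noteq> 0"
proof (subst AE_ball_countable, simp, rule ballI)
  fix i :: nat assume "i \<in> {1..}"
  then have i: "distributed M lborel (\<xi> i) (\<lambda>z. ennreal (rho z / lam))" by (intro xi_distr) simp
  have [measurable]: "\<xi> i \<in> borel_measurable M" using i by (auto simp: distributed_def)
  have "AE z in density lborel (\<lambda>z. ennreal (rho z / lam)). z \<noteq> 0"
    by (subst AE_density) (auto intro: eventually_mono[OF AE_lborel_singleton[of 0]])
  then have "AE z in distr M lborel (\<xi> i). z \<noteq> 0"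
    by (simp only: distributed_distr_eq_density[OF i])
  then show "AE \<omega> in M. \<xi> i \<omega> \<noteq> 0"
    by (subst (asm) AE_distr_iff) auto
qed

text \<open>Outcomes whose jumps up to \<open>t\<close> can be read off the path: positive gaps
  separate the times, one long gap makes them finitely many, and nonzero marks make each jump
  visible.\<close>

definition good :: "real \<Rightarrow> 'w \<Rightarrow> bool" where
  "good t \<omega> \<longleftrightarrow> (\<forall>j. 0 < E j \<omega>) \<and> (\<exists>j. t < E j \<omega>) \<and> (\<forall>i\<in>{1..}. \<xi> i \<omega> \<noteq> 0)"

lemma AE_good:
  assumes "0 \<le> t" shows "AE \<omega> in M. good t \<omega>"
  unfolding good_def using AE_E_pos AE_E_large[OF assms] AE_xi_nonzero by eventually_elim auto

lemma good_jump_time: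
  assumes "good t \<omega>" "i \<in> {1..count_proc E t \<omega>}"
  shows "0 < jump_time E i \<omega>" "jump_time E i \<omega> \<le> t"
  using assms jump_time_bounds[of E \<omega> t] by (auto simp: good_def)

lemma ou_int_compound_poisson:
  assumes "good t \<omega>" "0 \<le> t"
  shows "ou_int A (compound_poisson E \<xi>) t \<omega> = mark_sum (\<lambda>s z. mexp ((t - s) *\<^sub>R A) *v z) E \<xi> t \<omega>"
  unfolding ou_int_def mark_sum_def
proof (rule ou_step)
  show "compound_poisson E \<xi> s \<omega> = (\<Sum>i\<in>{1..count_proc E t \<omega>}. if jump_time E i \<omega> \<le> s then \<xi> i \<omega> else 0)"
    if "0 \<le> s" "s \<le> t" for s
    using compound_poisson_eq_step[of E \<omega> t _ s \<xi>] assms(1) that by (auto simp: good_def)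
qed (use assms good_jump_time in auto)

lemma grid_sum_compound_poisson:
  fixes g :: "real \<Rightarrow> real^'n \<Rightarrow> 'b::real_normed_vector"
  assumes \<omega>: "good t \<omega>" "0 < t" and g: "\<And>z. continuous_on UNIV (\<lambda>s. g s z)"
  shows "(\<lambda>m. grid_sum g t m (\<lambda>s. compound_poisson E \<xi> s \<omega>)) \<longlonglongrightarrow> mark_sum g E \<xi> t \<omega>"
  unfolding mark_sum_def
proof (rule grid_sum_tendsto[OF _ _ _ \<open>0 < t\<close> _ _ g])
  show "compound_poisson E \<xi> s \<omega> = (\<Sum>i\<in>{1..count_proc E t \<omega>}. if jump_time E i \<omega> \<le> s then \<xi> i \<omega> else 0)"
    if "0 \<le> s" "s \<le> t" for s
    using compound_poisson_eq_step[of E \<omega> t _ s \<xi>] \<omega>(1) that by (auto simp: good_def)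
  have "strict_mono (\<lambda>i. jump_time E i \<omega>)" using \<omega> by (intro jump_time_strict_mono) (auto simp: good_def)
  then show "inj_on (\<lambda>i. jump_time E i \<omega>) {1..count_proc E t \<omega>}"
    by (intro inj_on_subset[OF strict_mono_imp_inj_on]) auto
qed (use \<omega> good_jump_time in \<open>auto simp: good_def\<close>)

lemma indep_mark_sum:
  fixes g :: "real \<Rightarrow> real^'n \<Rightarrow> 'b::euclidean_space" and A :: "real^'n^'n"
  assumes L1_indep: "indep_rv M
        (Pi\<^sub>M {0..} (\<lambda>_. borel)) (\<lambda>\<omega>. restrict (\<lambda>t. L1 t \<omega>) {0..})
        (Pi\<^sub>M {0..} (\<lambda>_. borel)) (\<lambda>\<omega>. restrict (\<lambda>t. compound_poisson E \<xi> t \<omega>) {0..})"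
    and L1_cad: "\<And>\<omega>. \<omega> \<in> space M \<Longrightarrow> cadlag (\<lambda>t. L1 t \<omega>)"
    and t: "0 < t" and g: "\<And>z. continuous_on UNIV (\<lambda>s. g s z)"
    and gm: "(\<lambda>p. g (fst p) (snd p)) \<in> borel_measurable (borel \<Otimes>\<^sub>M borel)"
  shows "indep_rv M borel (ou_int A L1 t) borel (mark_sum g E \<xi> t)"
proof (rule indep_rv_vimage_algebra[OF L1_indep])
  let ?X = "\<lambda>\<omega>. restrict (\<lambda>t. L1 t \<omega>) {0..}" and ?Z = "\<lambda>\<omega>. restrict (\<lambda>t. compound_poisson E \<xi> t \<omega>) {0..}"
  let ?P = "Pi\<^sub>M {0..} (\<lambda>_. borel) :: (real \<Rightarrow> real^'n) measure"
  let ?F = "vimage_algebra (space M) ?X ?P" and ?G = "vimage_algebra (space M) ?Z ?P"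
  have XF: "?X \<in> ?F \<rightarrow>\<^sub>M ?P" by (rule measurable_vimage_algebra1) (auto simp: space_PiM)
  have ZG: "?Z \<in> ?G \<rightarrow>\<^sub>M ?P" by (rule measurable_vimage_algebra1) (auto simp: space_PiM)
  show "ou_int A L1 t \<in> borel_measurable ?F"
  proof (rule borel_measurable_ou_int)
    show "L1 s \<in> borel_measurable ?F" if "0 \<le> s" for s
      using measurable_compose[OF XF measurable_component_singleton[of s "{0..}"]] that by simp
  qed (use L1_cad t in auto)
  have Z[measurable]: "compound_poisson E \<xi> s \<in> borel_measurable ?G" if "0 \<le> s" for s
    using measurable_compose[OF ZG measurable_component_singleton[of s "{0..}"]] that by simp
  have gs[measurable]: "(\<lambda>z. g b z) \<in> borel_measurable borel" for b
    using measurable_compose[OF measurable_Pair1' gm, of b] by simp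
  have "(\<lambda>\<omega>. grid_sum g t m (\<lambda>s. compound_poisson E \<xi> s \<omega>)) \<in> borel_measurable ?G" for m
    unfolding grid_sum_def Let_def
  proof (rule borel_measurable_sum)
    fix k
    have [measurable]: "compound_poisson E \<xi> (t * real (Suc k) / real (Suc m)) \<in> borel_measurable ?G"
       "compound_poisson E \<xi> (t * real k / real (Suc m)) \<in> borel_measurable ?G"
      using t by (auto intro!: Z)
    show "(\<lambda>\<omega>. if compound_poisson E \<xi> (t * real (Suc k) / real (Suc m)) \<omega> - compound_poisson E \<xi> (t * real k / real (Suc m)) \<omega> = 0 then 0
        else g (t * real (Suc k) / real (Suc m)) (compound_poisson E \<xi> (t * real (Suc k) / real (Suc m)) \<omega> - compound_poisson E \<xi> (t * real k / real (Suc m)) \<omega>))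
        \<in> borel_measurable ?G"
      by measurable
  qed
  \<comment> \<open>\<open>lim\<close> of measurable maps is measurable whether or not the sequence
    converges, so no exceptional set has to be removed inside the path sigma-algebra.\<close>
  then show "(\<lambda>\<omega>. lim (\<lambda>m. grid_sum g t m (\<lambda>s. compound_poisson E \<xi> s \<omega>))) \<in> borel_measurable ?G"
    by (rule borel_measurable_lim_metric)
  show "mark_sum g E \<xi> t \<in> borel_measurable M"
    by (rule mark_sum_measurable[OF _ _ gm]) (auto intro: xi_measurable)
  have "AE \<omega> in M. good t \<omega>" using t by (intro AE_good) simp
  then show "AE \<omega> in M. mark_sum g E \<xi> t \<omega> = lim (\<lambda>m. grid_sum g t m (\<lambda>s. compound_poisson E \<xi> s \<omega>))"
    by eventually_elim (rule limI[OF grid_sum_compound_poisson[OF _ t g], symmetric])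
qed

end

section \<open>Weights\<close>

lemma sequence_coord_measurable:
  "(\<lambda>p. fst p j) \<in> borel_measurable (Pi\<^sub>M UNIV (\<lambda>_. borel) \<Otimes>\<^sub>M N)"
  by (rule measurable_compose[OF measurable_fst measurable_component_singleton]) simp

lemma mark_coord_measurable:
  "i \<in> I \<Longrightarrow> (\<lambda>p. snd p i) \<in> borel_measurable (N \<Otimes>\<^sub>M Pi\<^sub>M I (\<lambda>_. borel))"
  by (rule measurable_compose[OF measurable_snd measurable_component_singleton])

lemma count_proc_sequence: "count_proc (\<lambda>j p. fst p j) t (\<lambda>j. E j \<omega>, z) = count_proc E t \<omega>"
  by (simp add: count_proc_def jump_time_def)

text \<open>Times come from \<open>\<omega>\<close> and marks from a second outcome
  \<open>\<omega>'\<close>: the form that arises when the times are frozen and the marks are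
  averaged.\<close>

lemma mark_sum_sequence:
  "mark_sum g (\<lambda>j p. fst p j) (\<lambda>i p. snd p i) t (\<lambda>j. E j \<omega>, restrict (\<lambda>i. \<xi> i \<omega>') {1..})
    = (\<Sum>i\<in>{1..count_proc E t \<omega>}. g (jump_time E i \<omega>) (\<xi> i \<omega>'))"
  unfolding mark_sum_def count_proc_sequence by (simp add: jump_time_def)

lemma mexp_vec_measurable:
  fixes B :: "real^'n^'n"
  shows "(\<lambda>p. mexp (fst p *\<^sub>R B) *v snd p) \<in> borel_measurable (borel \<Otimes>\<^sub>M borel)"
proof -
  have "continuous_on UNIV (\<lambda>p. mexp (fst p *\<^sub>R B) *v snd p)"
    by (intro bounded_bilinear.continuous_on[OF bounded_bilinear_matrix_vector_mult]
        continuous_on_compose2[OF continuous_on_mexp[of UNIV]] continuous_intros) auto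
  then show ?thesis by (simp add: borel_prod borel_measurable_continuous_onI)
qed

lemma continuous_on_mexp_vec: "continuous_on UNIV (\<lambda>s. mexp (s *\<^sub>R B) *v v)"
  by (intro bounded_bilinear.continuous_on[OF bounded_bilinear_matrix_vector_mult]
        continuous_on_mexp continuous_intros)

context jump_process
begin

text \<open>Dominates the norm of the weight up to the bound on \<open>mexp\<close>. It is 0 when
  there is no jump.\<close>

definition average_score :: "real \<Rightarrow> 'w \<Rightarrow> real" where
  "average_score t \<omega> = (1 / real (count_proc E t \<omega>)) * mark_sum (\<lambda>s z. norm (score z)) E \<xi> t \<omega>"

lemma average_score_measurable [measurable]: "average_score t \<in> borel_measurable M"
proof -
  have [measurable]: "mark_sum (\<lambda>s z. norm (score z)) E \<xi> t \<in> borel_measurable M"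
    by (rule mark_sum_measurable) (auto intro: xi_measurable)
  show ?thesis unfolding average_score_def[abs_def] by measurable
qed

lemma average_score_nonneg: "0 \<le> average_score t \<omega>"
  unfolding average_score_def mark_sum_def by (intro mult_nonneg_nonneg sum_nonneg) auto

text \<open>Almost surely the counted indices form an initial segment, so the count is positive
  exactly when the first gap, exponential with rate \<open>lam\<close>, is at most
  \<open>t\<close>.\<close>

lemma prob_count_pos:
  assumes "0 \<le> t" shows "prob {\<omega>\<in>space M. 1 \<le> count_proc E t \<omega>} = 1 - exp (- lam * t)"
proof -
  have "AE \<omega> in M. 1 \<le> count_proc E t \<omega> \<longleftrightarrow> E 0 \<omega> \<le> t"
    using AE_good[OF assms]
  proof eventually_elim
    case (elim \<omega>)
    then obtain j where "\<And>j. 0 < E j \<omega>" "t < E j \<omega>" by (auto simp: good_def)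
    from jump_times_upto[of E \<omega>, OF this order_refl]
    have "1 \<in> {1..count_proc E t \<omega>} \<longleftrightarrow> jump_time E 1 \<omega> \<le> t" by blast
    then show ?case by (simp add: jump_time_def)
  qed
  then have "prob {\<omega>\<in>space M. 1 \<le> count_proc E t \<omega>} = prob {\<omega>\<in>space M. E 0 \<omega> \<le> t}"
    by (intro measure_eq_AE) (auto simp: E_measurable)
  then show ?thesis using prob_E_le[OF assms, of 0] by (simp add: mult.commute)
qed

text \<open>Given the times, each of the \<open>n\<close> marks contributes the same mean, so the
  average does not depend on \<open>n\<close> as long as \<open>n \<ge> 1\<close>; integrating over
  the times leaves the probability of at least one jump.\<close>

lemma nn_integral_average_score:
  assumes "0 \<le> t"
  shows "(\<integral>\<^sup>+\<omega>. ennreal (average_score t \<omega>) \<partial>M)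
    = ennreal ((1 - exp (- lam * t)) * ((\<integral>z. norm (grad rho z) \<partial>lborel) / lam))"
proof -
  let ?\<kappa> = "(\<integral>z. norm (grad rho z) \<partial>lborel) / lam"
  have \<kappa>: "0 \<le> ?\<kappa>" using lam_pos by simp
  define \<psi> where "\<psi> p = ennreal ((1 / real (count_proc (\<lambda>j p. fst p j) t p)) *
      mark_sum (\<lambda>s z. norm (score z)) (\<lambda>j p. fst p j) (\<lambda>i p. snd p i) t p)" for p :: "(nat \<Rightarrow> real) \<times> (nat \<Rightarrow> real^'n)"
  let ?S = "Pi\<^sub>M UNIV (\<lambda>_. borel) \<Otimes>\<^sub>M Pi\<^sub>M {1..} (\<lambda>_. borel) :: ((nat \<Rightarrow> real) \<times> (nat \<Rightarrow> real^'n)) measure"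
  have [measurable]: "mark_sum (\<lambda>s z. norm (score z)) (\<lambda>j p. fst p j) (\<lambda>i p. snd p i) t \<in> borel_measurable ?S"
    by (rule mark_sum_measurable) (auto intro!: sequence_coord_measurable mark_coord_measurable)
  have [measurable]: "count_proc (\<lambda>j p. fst p j) t \<in> ?S \<rightarrow>\<^sub>M count_space UNIV"
    by (rule count_proc_measurable) (rule sequence_coord_measurable)
  have \<psi>[measurable]: "\<psi> \<in> borel_measurable ?S" unfolding \<psi>_def[abs_def] by measurable
  have \<psi>_eq: "\<psi> (\<lambda>j. E j \<omega>, restrict (\<lambda>i. \<xi> i \<omega>') {1..})
     = ennreal ((1 / real (count_proc E t \<omega>)) * (\<Sum>i\<in>{1..count_proc E t \<omega>}. norm (score (\<xi> i \<omega>'))))" for \<omega> \<omega>'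
    unfolding \<psi>_def mark_sum_sequence count_proc_sequence ..
  have "(\<integral>\<^sup>+\<omega>. ennreal (average_score t \<omega>) \<partial>M) = (\<integral>\<^sup>+\<omega>. \<psi> (\<lambda>j. E j \<omega>, restrict (\<lambda>i. \<xi> i \<omega>) {1..}) \<partial>M)"
    unfolding \<psi>_eq average_score_def mark_sum_def ..
  also have "\<dots> = (\<integral>\<^sup>+\<omega>. \<integral>\<^sup>+\<omega>'. \<psi> (\<lambda>j. E j \<omega>, restrict (\<lambda>i. \<xi> i \<omega>') {1..}) \<partial>M \<partial>M)"
    by (rule indep_rv_nn_integral[OF xi_E_indep \<psi>])
  also have "\<dots> = (\<integral>\<^sup>+\<omega>. ennreal ?\<kappa> * indicator {\<omega>\<in>space M. 1 \<le> count_proc E t \<omega>} \<omega> \<partial>M)"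
  proof (rule nn_integral_cong)
    fix \<omega> assume "\<omega> \<in> space M"
    define n where "n = count_proc E t \<omega>"
    have "(\<integral>\<^sup>+\<omega>'. \<psi> (\<lambda>j. E j \<omega>, restrict (\<lambda>i. \<xi> i \<omega>') {1..}) \<partial>M)
       = (\<integral>\<^sup>+\<omega>'. ennreal (1 / real n) * (\<Sum>i\<in>{1..n}. ennreal (norm (score (\<xi> i \<omega>')))) \<partial>M)"
      unfolding \<psi>_eq n_def[symmetric] by (intro nn_integral_cong) (simp only: ennreal_mult'' sum_nonneg norm_ge_zero sum_ennreal)
    also have "\<dots> = ennreal (1 / real n) * (\<Sum>i\<in>{1..n}. \<integral>\<^sup>+\<omega>'. ennreal (norm (score (\<xi> i \<omega>'))) \<partial>M)"
    proof -
      have m: "(\<lambda>\<omega>'. ennreal (norm (score (\<xi> i \<omega>')))) \<in> borel_measurable M" if "i \<in> {1..n}" for i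
        using that by (intro measurable_compose[OF xi_measurable]) auto
      have "(\<integral>\<^sup>+\<omega>'. ennreal (1 / real n) * (\<Sum>i\<in>{1..n}. ennreal (norm (score (\<xi> i \<omega>')))) \<partial>M)
        = ennreal (1 / real n) * (\<integral>\<^sup>+\<omega>'. (\<Sum>i\<in>{1..n}. ennreal (norm (score (\<xi> i \<omega>')))) \<partial>M)"
        by (rule nn_integral_cmult) (rule borel_measurable_sum[OF m])
      also have "(\<integral>\<^sup>+\<omega>'. (\<Sum>i\<in>{1..n}. ennreal (norm (score (\<xi> i \<omega>')))) \<partial>M)
        = (\<Sum>i\<in>{1..n}. \<integral>\<^sup>+\<omega>'. ennreal (norm (score (\<xi> i \<omega>'))) \<partial>M)"
        by (rule nn_integral_sum) (rule m)
      finally show ?thesis .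
    qed
    also have "\<dots> = ennreal (1 / real n) * (\<Sum>i\<in>{1..n}. ennreal ?\<kappa>)"
      by (intro arg_cong2[where f="(*)"] refl sum.cong nn_integral_norm_score xi_distr) auto
    \<comment> \<open>For \<open>n = 0\<close> the convention \<open>1 / 0 = 0\<close> matches the
      vanishing indicator; otherwise \<open>n\<close> equal terms cancel the factor
      \<open>1 / n\<close>.\<close>
    also have "\<dots> = ennreal ?\<kappa> * indicator {\<omega>\<in>space M. 1 \<le> count_proc E t \<omega>} \<omega>"
      using \<open>\<omega> \<in> space M\<close> \<kappa> by (cases "n = 0")
        (auto simp: n_def[symmetric] ennreal_of_nat_eq_real_of_nat mult.assoc[symmetric] ennreal_mult'[symmetric])
    finally show "(\<integral>\<^sup>+\<omega>'. \<psi> (\<lambda>j. E j \<omega>, restrict (\<lambda>i. \<xi> i \<omega>') {1..}) \<partial>M)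
       = ennreal ?\<kappa> * indicator {\<omega>\<in>space M. 1 \<le> count_proc E t \<omega>} \<omega>" .
  qed
  also have "\<dots> = ennreal ?\<kappa> * emeasure M {\<omega>\<in>space M. 1 \<le> count_proc E t \<omega>}"
    by (rule nn_integral_cmult_indicator) (auto simp: E_measurable)
  also have "\<dots> = ennreal ((1 - exp (- lam * t)) * ?\<kappa>)"
    using \<kappa> unfolding emeasure_eq_measure prob_count_pos[OF assms]
    by (subst mult.commute) (rule ennreal_mult''[symmetric])
  finally show ?thesis .
qed

lemma integrable_average_score:
  assumes "0 \<le> t" shows "integrable M (average_score t)"
  by (rule integrableI_nonneg) (auto simp: nn_integral_average_score[OF assms] average_score_nonneg)

lemma integral_average_score:
  assumes "0 \<le> t"
  shows "(\<integral>\<omega>. average_score t \<omega> \<partial>M) = (1 - exp (- lam * t)) * ((\<integral>z. norm (grad rho z) \<partial>lborel) / lam)"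
proof -
  have "0 \<le> (1 - exp (- lam * t)) * ((\<integral>z. norm (grad rho z) \<partial>lborel) / lam)"
    using assms lam_pos by (intro mult_nonneg_nonneg) auto
  then show ?thesis
    by (subst integral_eq_nn_integral) (auto simp: nn_integral_average_score[OF assms] average_score_nonneg)
qed

end

section \<open>The weight and the decomposition of the process\<close>

locale ou_setup = jump_process M rho \<epsilon> lam E \<xi>
  for M :: "'w measure" and rho :: "real^'n \<Rightarrow> real" and \<epsilon> lam E \<xi> +
  fixes A :: "real^'n^'n" and L1 L :: "real \<Rightarrow> 'w \<Rightarrow> real^'n"
  assumes L1_indep: "indep_rv M
        (Pi\<^sub>M {0..} (\<lambda>_. borel)) (\<lambda>\<omega>. restrict (\<lambda>t. L1 t \<omega>) {0..})
        (Pi\<^sub>M {0..} (\<lambda>_. borel)) (\<lambda>\<omega>. restrict (\<lambda>t. compound_poisson E \<xi> t \<omega>) {0..})"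
    and L1_cad: "\<And>\<omega>. \<omega> \<in> space M \<Longrightarrow> cadlag (\<lambda>t. L1 t \<omega>)"
    and L_cad: "\<And>\<omega>. \<omega> \<in> space M \<Longrightarrow> cadlag (\<lambda>t. L t \<omega>)"
    and L_measurable: "\<And>t. L t \<in> borel_measurable M"
    and L_eq: "\<And>t \<omega>. L t \<omega> = L1 t \<omega> + compound_poisson E \<xi> t \<omega>"
begin

definition weight :: "real \<Rightarrow> 'w \<Rightarrow> real^'n" where
  "weight t \<omega> = (1 / real (count_proc E t \<omega>)) *\<^sub>R
     mark_sum (\<lambda>s z. mexp (s *\<^sub>R transpose A) *v score z) E \<xi> t \<omega>"

text \<open>Per-jump contributions to the process at time \<open>t\<close>, to the count and to the
  unnormalised weight. Summing them as one vector makes a single application of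
  \<open>indep_mark_sum\<close> give joint independence from \<open>L1\<close>.\<close>

definition jump_data :: "real \<Rightarrow> real \<Rightarrow> real^'n \<Rightarrow> (real^'n) \<times> real \<times> (real^'n)" where
  "jump_data t s z = (mexp ((t - s) *\<^sub>R A) *v z, 1, mexp (s *\<^sub>R transpose A) *v score z)"

lemma jump_data_measurable: "(\<lambda>p. jump_data t (fst p) (snd p)) \<in> borel_measurable (borel \<Otimes>\<^sub>M borel)"
proof -
  have "(\<lambda>p. (t - fst p, snd p)) \<in> borel \<Otimes>\<^sub>M borel \<rightarrow>\<^sub>M borel \<Otimes>\<^sub>M (borel :: (real^'n) measure)" by measurable
  from measurable_compose[OF this mexp_vec_measurable[of A]]
  have [measurable]: "(\<lambda>p. mexp ((t - fst p) *\<^sub>R A) *v snd p) \<in> borel_measurable (borel \<Otimes>\<^sub>M borel)" by simp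
  have "(\<lambda>p. (fst p, score (snd p))) \<in> borel \<Otimes>\<^sub>M borel \<rightarrow>\<^sub>M borel \<Otimes>\<^sub>M (borel :: (real^'n) measure)" by measurable
  from measurable_compose[OF this mexp_vec_measurable[of "transpose A"]]
  have [measurable]: "(\<lambda>p. mexp (fst p *\<^sub>R transpose A) *v score (snd p)) \<in> borel_measurable (borel \<Otimes>\<^sub>M borel)" by simp
  show ?thesis unfolding jump_data_def by measurable
qed

lemma continuous_on_jump_data: "continuous_on UNIV (\<lambda>s. jump_data t s z)"
  unfolding jump_data_def
  by (intro continuous_on_Pair continuous_on_const continuous_on_mexp_vec
      continuous_on_compose2[OF continuous_on_mexp_vec[of A z], of UNIV "\<lambda>s. t - s"] continuous_intros) auto

lemma sum_jump_data:
  "(\<Sum>i\<in>I. jump_data t (s i) (z i)) = (\<Sum>i\<in>I. mexp ((t - s i) *\<^sub>R A) *v z i, real (card I),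
     \<Sum>i\<in>I. mexp (s i *\<^sub>R transpose A) *v score (z i))"
  unfolding jump_data_def sum_prod by simp

lemma mark_sum_jump_data:
  "mark_sum (jump_data t) E \<xi> t \<omega> = (mark_sum (\<lambda>s z. mexp ((t - s) *\<^sub>R A) *v z) E \<xi> t \<omega>, real (count_proc E t \<omega>),
     mark_sum (\<lambda>s z. mexp (s *\<^sub>R transpose A) *v score z) E \<xi> t \<omega>)"
  unfolding mark_sum_def sum_jump_data by simp

lemma weight_measurable [measurable]: "weight t \<in> borel_measurable M"
proof -
  have "(\<lambda>p. (fst p, score (snd p))) \<in> borel \<Otimes>\<^sub>M borel \<rightarrow>\<^sub>M borel \<Otimes>\<^sub>M (borel :: (real^'n) measure)" by measurable
  from measurable_compose[OF this mexp_vec_measurable[of "transpose A"]]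
  have [measurable]: "mark_sum (\<lambda>s z. mexp (s *\<^sub>R transpose A) *v score z) E \<xi> t \<in> borel_measurable M"
    by (intro mark_sum_measurable) (auto intro: xi_measurable)
  show ?thesis unfolding weight_def[abs_def] by measurable
qed

lemma norm_weight_le:
  assumes diss: "\<And>v. v \<bullet> (A *v v) \<le> - \<theta> * (norm v)\<^sup>2" and "good t \<omega>"
  shows "norm (weight t \<omega>) \<le> exp (max (- \<theta>) 0 * t) * average_score t \<omega>"
proof -
  let ?I = "{1..count_proc E t \<omega>}" and ?C = "exp (max (- \<theta>) 0 * t)"
  \<comment> \<open>A matrix and its transpose have the same quadratic form, so the exponential
    bound applies to both with the same rate.\<close>
  have dissT: "v \<bullet> (transpose A *v v) \<le> - \<theta> * (norm v)\<^sup>2" for v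
    using diss[of v] by (simp add: inner_commute[of v] dot_lmul_matrix)
  have "norm (\<Sum>i\<in>?I. mexp (jump_time E i \<omega> *\<^sub>R transpose A) *v score (\<xi> i \<omega>)) \<le> (\<Sum>i\<in>?I. ?C * norm (score (\<xi> i \<omega>)))"
    using good_jump_time[OF \<open>good t \<omega>\<close>] by (intro sum_norm_le norm_mexp_le[OF dissT]) (auto intro: less_imp_le)
  then have "norm (weight t \<omega>) \<le> (1 / real (count_proc E t \<omega>)) * (\<Sum>i\<in>?I. ?C * norm (score (\<xi> i \<omega>)))"
    unfolding weight_def mark_sum_def norm_scaleR by (auto intro!: divide_right_mono)
  then show ?thesis unfolding average_score_def mark_sum_def by (simp add: sum_distrib_left[symmetric])
qed

lemma integrable_weight:
  assumes "0 \<le> t" shows "integrable M (weight t)"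
proof -
  obtain \<theta> where \<theta>: "\<And>v. v \<bullet> (A *v v) \<le> - \<theta> * (norm v)\<^sup>2" using dissipative_ex[of A] by blast
  show ?thesis
  proof (rule Bochner_Integration.integrable_bound)
    show "integrable M (\<lambda>\<omega>. exp (max (- \<theta>) 0 * t) * average_score t \<omega>)"
      using integrable_average_score[OF assms] by simp
    show "AE \<omega> in M. norm (weight t \<omega>) \<le> norm (exp (max (- \<theta>) 0 * t) * average_score t \<omega>)"
      using AE_good[OF assms] by eventually_elim (use norm_weight_le[OF \<theta>] average_score_nonneg in auto)
  qed simp
qed

lemma ou_proc_measurable: "0 \<le> t \<Longrightarrow> ou_proc A L x t \<in> borel_measurable M"
  unfolding ou_proc_def[abs_def] using L_measurable L_cad
  by (intro borel_measurable_add borel_measurable_const borel_measurable_ou_int) auto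

lemma ou_proc_decomp:
  assumes \<omega>: "\<omega> \<in> space M" "good t \<omega>" and "0 \<le> t"
  shows "ou_proc A L x t \<omega> = mexp (t *\<^sub>R A) *v x + ou_int A L1 t \<omega> + fst (mark_sum (jump_data t) E \<xi> t \<omega>)"
proof -
  \<comment> \<open>The compound Poisson path is the difference of the paths of \<open>L\<close> and
    \<open>L1\<close>, which avoids any study of its own jumps.\<close>
  have cad0: "cadlag (\<lambda>s. compound_poisson E \<xi> s \<omega>)"
    using cadlag_diff[OF L_cad[OF \<omega>(1)] L1_cad[OF \<omega>(1)]] by (simp add: L_eq)
  have "ou_int A L t \<omega> = ou_int A L1 t \<omega> + ou_int A (compound_poisson E \<xi>) t \<omega>"
    unfolding ou_int_def L_eq matrix_vector_right_distrib
    using cadlag_ou_integrable[OF cad0 \<open>0 \<le> t\<close>] cadlag_ou_integrable[OF L1_cad[OF \<omega>(1)] \<open>0 \<le> t\<close>]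
    by (subst Henstock_Kurzweil_Integration.integral_add) auto
  then show ?thesis
    using ou_int_compound_poisson[OF \<omega>(2) \<open>0 \<le> t\<close>] by (simp add: ou_proc_def mark_sum_jump_data add.assoc)
qed

end

section \<open>Differentiation of the restricted semigroup\<close>

context ou_setup
begin

definition P1 :: "real \<Rightarrow> (real^'n \<Rightarrow> real) \<Rightarrow> real^'n \<Rightarrow> real" where
  "P1 t f x = (\<integral>\<omega>. f (ou_proc A L x t \<omega>) * indicator {\<omega>. 1 \<le> count_proc E t \<omega>} \<omega> \<partial>M)"

definition DP1 :: "real \<Rightarrow> (real^'n \<Rightarrow> real) \<Rightarrow> real^'n \<Rightarrow> real^'n" where
  "DP1 t f x = - (\<integral>\<omega>. (f (ou_proc A L x t \<omega>) * indicator {\<omega>. 1 \<le> count_proc E t \<omega>} \<omega>) *\<^sub>R weight t \<omega> \<partial>M)"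

text \<open>Integrand of the first-order error of \<open>P1\<close> at \<open>x\<close> in direction
  \<open>k\<close>: \<open>a\<close> and \<open>c\<close> stand for the images of \<open>x\<close>
  and \<open>k\<close> under \<open>mexp (t A)\<close>, \<open>y\<close> for the contribution of
  \<open>L1\<close>, and the remaining triple for the sums of \<open>jump_data\<close>. The count
  appears as a real \<open>n\<close>, and the indicator encodes at least one jump.\<close>

definition first_order :: "(real^'n \<Rightarrow> real) \<Rightarrow> real^'n \<Rightarrow> real^'n \<Rightarrow> real^'n \<Rightarrow> (real^'n) \<times> (real^'n) \<times> real \<times> (real^'n) \<Rightarrow> real" where
  "first_order f a c k = (\<lambda>(y, w, n, \<gamma>). (f (a + y + w + c) - f (a + y + w) + f (a + y + w) * ((1 / n) * (\<gamma> \<bullet> k)))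
      * indicator {1..} n)"

context
  fixes t :: real and f :: "real^'n \<Rightarrow> real" and K :: real
  assumes t: "0 < t" and f[measurable]: "f \<in> borel_measurable borel" and fK: "\<And>z. \<bar>f z\<bar> \<le> K"
begin

lemma K_nonneg: "0 \<le> K"
  using fK[of 0] by linarith

lemma first_order_measurable [measurable]: "first_order f a c k \<in> borel_measurable (borel \<Otimes>\<^sub>M borel)"
  unfolding first_order_def borel_prod[symmetric] by measurable

lemma jump_sum_measurable [measurable]: "mark_sum (jump_data t) E \<xi> t \<in> borel_measurable M"
  by (rule mark_sum_measurable[OF _ _ jump_data_measurable]) (auto intro: xi_measurable)

lemma integrable_first_order:
  assumes [measurable]: "U \<in> borel_measurable M"
  shows "integrable M (\<lambda>\<omega>. first_order f a c k (U \<omega>, mark_sum (jump_data t) E \<xi> t \<omega>))"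
proof (rule Bochner_Integration.integrable_bound)
  show "integrable M (\<lambda>\<omega>. 2 * K + K * \<bar>weight t \<omega> \<bullet> k\<bar>)"
    using integrable_weight[of t] t by auto
  show "AE \<omega> in M. norm (first_order f a c k (U \<omega>, mark_sum (jump_data t) E \<xi> t \<omega>)) \<le> norm (2 * K + K * \<bar>weight t \<omega> \<bullet> k\<bar>)"
  proof (intro AE_I2)
    fix \<omega>
    let ?w = "a + U \<omega> + mark_sum (\<lambda>s z. mexp ((t - s) *\<^sub>R A) *v z) E \<xi> t \<omega>" and ?s = "weight t \<omega> \<bullet> k"
    have eq: "first_order f a c k (U \<omega>, mark_sum (jump_data t) E \<xi> t \<omega>)
      = (f (?w + c) - f ?w + f ?w * ?s) * indicator {1..} (real (count_proc E t \<omega>))"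
      by (simp add: first_order_def mark_sum_jump_data weight_def)
    have "\<bar>f ?w * ?s\<bar> \<le> K * \<bar>?s\<bar>" using fK by (auto simp: abs_mult intro!: mult_right_mono)
    moreover have "\<bar>f (?w + c)\<bar> \<le> K" "\<bar>f ?w\<bar> \<le> K" using fK by auto
    ultimately have "\<bar>f (?w + c) - f ?w + f ?w * ?s\<bar> \<le> 2 * K + K * \<bar>?s\<bar>" by linarith
    then show "norm (first_order f a c k (U \<omega>, mark_sum (jump_data t) E \<xi> t \<omega>)) \<le> norm (2 * K + K * \<bar>?s\<bar>)"
      unfolding eq using K_nonneg by (auto simp: abs_mult indicator_def)
  qed
qed measurable

text \<open>The contribution of \<open>L1\<close> is frozen at \<open>y\<close>; now the
  interarrival times are frozen too and the marks averaged. By the semigroup law the displacement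
  \<open>mexp (t A) k\<close> factors through each jump time, so \<open>average_shift_bound\<close>
  applies to all jumps with one bound \<open>D\<close>.\<close>

lemma first_order_fixed_bound:
  assumes D: "\<And>s. 0 \<le> s \<Longrightarrow> s \<le> t \<Longrightarrow> (\<integral>z. \<bar>taylor_rem (mexp (s *\<^sub>R A) *v k) z\<bar> \<partial>lborel) \<le> D"
  shows "\<bar>\<integral>\<omega>. first_order f a (mexp (t *\<^sub>R A) *v k) k (y, mark_sum (jump_data t) E \<xi> t \<omega>) \<partial>M\<bar> \<le> K / lam * D"
proof -
  let ?c = "mexp (t *\<^sub>R A) *v k"
  have "0 \<le> (\<integral>z. \<bar>taylor_rem (mexp (0 *\<^sub>R A) *v k) z\<bar> \<partial>lborel)" by simp
  with D[of 0] t have D0: "0 \<le> D" by linarith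
  let ?V = "mark_sum (jump_data t) (\<lambda>j p. fst p j) (\<lambda>i p. snd p i) t"
  let ?S = "Pi\<^sub>M UNIV (\<lambda>_. borel) \<Otimes>\<^sub>M Pi\<^sub>M {1..} (\<lambda>_. borel) :: ((nat \<Rightarrow> real) \<times> (nat \<Rightarrow> real^'n)) measure"
  have [measurable]: "?V \<in> borel_measurable ?S"
    by (rule mark_sum_measurable[OF _ _ jump_data_measurable])
       (auto intro!: sequence_coord_measurable mark_coord_measurable)
  have V_eq: "?V (\<lambda>j. E j \<omega>, restrict (\<lambda>i. \<xi> i \<omega>') {1..}) =
     (\<Sum>i\<in>{1..count_proc E t \<omega>}. jump_data t (jump_time E i \<omega>) (\<xi> i \<omega>'))" for \<omega> \<omega>'
    by (rule mark_sum_sequence)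
  have V_diag: "?V (\<lambda>j. E j \<omega>, restrict (\<lambda>i. \<xi> i \<omega>) {1..}) = mark_sum (jump_data t) E \<xi> t \<omega>" for \<omega>
    unfolding V_eq unfolding mark_sum_def ..
  have "\<bar>\<integral>\<omega>. first_order f a ?c k (y, ?V (\<lambda>j. E j \<omega>, restrict (\<lambda>i. \<xi> i \<omega>) {1..})) \<partial>M\<bar> \<le> K / lam * D"
  proof (rule indep_rv_integral_bound[OF xi_E_indep, where \<psi>="\<lambda>p. first_order f a ?c k (y, ?V p)"])
    show "(\<lambda>p. first_order f a ?c k (y, ?V p)) \<in> borel_measurable ?S" by measurable
    show "integrable M (\<lambda>\<omega>. first_order f a ?c k (y, ?V (\<lambda>j. E j \<omega>, restrict (\<lambda>i. \<xi> i \<omega>) {1..})))"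
      unfolding V_diag by (rule integrable_first_order) simp
    have "AE \<omega> in M. good t \<omega>" using t by (intro AE_good) simp
    then show "AE \<omega> in M. \<bar>\<integral>\<omega>'. first_order f a ?c k (y, ?V (\<lambda>j. E j \<omega>, restrict (\<lambda>i. \<xi> i \<omega>') {1..})) \<partial>M\<bar> \<le> K / lam * D"
    proof eventually_elim
      case (elim \<omega>)
      define I where "I = {1..count_proc E t \<omega>}"
      define \<tau> where "\<tau> i = jump_time E i \<omega>" for i
      have \<tau>: "0 \<le> \<tau> i" "\<tau> i \<le> t" if "i \<in> I" for i
        using good_jump_time[OF elim] that by (auto simp: I_def \<tau>_def intro: less_imp_le)
      show ?case
      proof (cases "I = {}")
        case True
        then have "first_order f a ?c k (y, ?V (\<lambda>j. E j \<omega>, restrict (\<lambda>i. \<xi> i \<omega>') {1..})) = 0" for \<omega>'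
          unfolding V_eq I_def[symmetric] sum_jump_data by (simp add: first_order_def)
        then show ?thesis using K_nonneg lam_pos D0 by simp
      next
        case False
        then have card: "card I \<ge> 1" unfolding I_def by simp
        \<comment> \<open>Passing to the adjoint moves the exponential from the score to
          \<open>k\<close>; the weight thus pairs each score with precisely the displacement that
          its mark undergoes.\<close>
        have adj: "(mexp (s *\<^sub>R transpose A) *v u) \<bullet> k = u \<bullet> (mexp (s *\<^sub>R A) *v k)" for s u
        proof -
          have "s *\<^sub>R transpose A = transpose (s *\<^sub>R A)" by (simp add: transpose_def vec_eq_iff)
          then show ?thesis by (simp add: mexp_transpose dot_lmul_matrix)
        qed
        have eq: "first_order f a ?c k (y, ?V (\<lambda>j. E j \<omega>, restrict (\<lambda>i. \<xi> i \<omega>') {1..}))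
          = f ((a + y) + (\<Sum>i\<in>I. mexp ((t - \<tau> i) *\<^sub>R A) *v \<xi> i \<omega>') + ?c) - f ((a + y) + (\<Sum>i\<in>I. mexp ((t - \<tau> i) *\<^sub>R A) *v \<xi> i \<omega>'))
           + f ((a + y) + (\<Sum>i\<in>I. mexp ((t - \<tau> i) *\<^sub>R A) *v \<xi> i \<omega>')) *
             ((1 / real (card I)) * (\<Sum>i\<in>I. score (\<xi> i \<omega>') \<bullet> (mexp (\<tau> i *\<^sub>R A) *v k)))" for \<omega>'
          unfolding V_eq I_def[symmetric] \<tau>_def[symmetric] sum_jump_data first_order_def
          using card by (simp add: inner_sum_left adj)
        show ?thesis unfolding eq
        proof (rule average_shift_bound[OF prob_space_axioms xi_indep])
          show "finite I" "I \<subseteq> {1..}" unfolding I_def by auto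
          show "mexp ((t - \<tau> i) *\<^sub>R A) *v (mexp (\<tau> i *\<^sub>R A) *v k) = ?c" for i
            by (simp add: matrix_vector_mul_assoc mexp_semigroup)
          show "distributed M lborel (\<xi> i) (\<lambda>z. ennreal (rho z / lam))" if "i \<in> I" for i
            using that by (intro xi_distr) (simp add: I_def)
          show "(\<integral>z. \<bar>taylor_rem (mexp (\<tau> i *\<^sub>R A) *v k) z\<bar> \<partial>lborel) \<le> D" if "i \<in> I" for i
            using \<tau>[OF that] by (rule D)
        qed (use False fK in auto)
      qed
    qed
  qed
  then show ?thesis unfolding V_diag .
qed

lemma integrable_f_ou: "integrable M (\<lambda>\<omega>. f (ou_proc A L x t \<omega>) * indicator {\<omega>. 1 \<le> count_proc E t \<omega>} \<omega>)"
proof -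
  have [measurable]: "ou_proc A L x t \<in> borel_measurable M" using t by (intro ou_proc_measurable) simp
  show ?thesis
    using fK K_nonneg by (intro integrable_const_bound[where B=K] AE_I2) (auto simp: indicator_def)
qed

lemma integrable_f_ou_weight:
  "integrable M (\<lambda>\<omega>. (f (ou_proc A L x t \<omega>) * indicator {\<omega>. 1 \<le> count_proc E t \<omega>} \<omega>) *\<^sub>R weight t \<omega>)"
proof (rule Bochner_Integration.integrable_bound)
  have [measurable]: "ou_proc A L x t \<in> borel_measurable M" using t by (intro ou_proc_measurable) simp
  show "integrable M (\<lambda>\<omega>. K *\<^sub>R weight t \<omega>)" using integrable_weight[of t] t by auto
  show "(\<lambda>\<omega>. (f (ou_proc A L x t \<omega>) * indicator {\<omega>. 1 \<le> count_proc E t \<omega>} \<omega>) *\<^sub>R weight t \<omega>) \<in> borel_measurable M"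
    by measurable
  show "AE \<omega> in M. norm ((f (ou_proc A L x t \<omega>) * indicator {\<omega>. 1 \<le> count_proc E t \<omega>} \<omega>) *\<^sub>R weight t \<omega>) \<le> norm (K *\<^sub>R weight t \<omega>)"
    using fK K_nonneg by (intro AE_I2) (auto simp: indicator_def intro!: mult_right_mono)
qed

text \<open>The error is the mean of \<open>first_order\<close> at the independent pair formed by
  the \<open>L1\<close> contribution and the jump sums; freezing the former reduces it to
  \<open>first_order_fixed_bound\<close>.\<close>

lemma P1_expansion:
  assumes D: "\<And>s. 0 \<le> s \<Longrightarrow> s \<le> t \<Longrightarrow> (\<integral>z. \<bar>taylor_rem (mexp (s *\<^sub>R A) *v k) z\<bar> \<partial>lborel) \<le> D"
  shows "\<bar>P1 t f (x + k) - P1 t f x - k \<bullet> DP1 t f x\<bar> \<le> K / lam * D"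
proof -
  let ?a = "mexp (t *\<^sub>R A) *v x" and ?c = "mexp (t *\<^sub>R A) *v k"
  have indep: "indep_rv M borel (ou_int A L1 t) borel (mark_sum (jump_data t) E \<xi> t)"
    using L1_indep L1_cad t continuous_on_jump_data jump_data_measurable by (rule indep_mark_sum)
  then have [measurable]: "ou_int A L1 t \<in> borel_measurable M" by (simp add: indep_rv_def)
  let ?F = "\<lambda>x \<omega>. f (ou_proc A L x t \<omega>) * indicator {\<omega>. 1 \<le> count_proc E t \<omega>} \<omega>"
  have "k \<bullet> DP1 t f x = - (\<integral>\<omega>. (?F x \<omega> *\<^sub>R weight t \<omega>) \<bullet> k \<partial>M)"
    unfolding DP1_def
    by (subst integral_inner_left) (simp_all only: integrable_f_ou_weight inner_commute[of k] inner_minus_left)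
  then have "P1 t f (x + k) - P1 t f x - k \<bullet> DP1 t f x = (\<integral>\<omega>. ?F (x + k) \<omega> - ?F x \<omega> + (?F x \<omega> *\<^sub>R weight t \<omega>) \<bullet> k \<partial>M)"
    unfolding P1_def using integrable_f_ou[of x] integrable_f_ou[of "x + k"] integrable_f_ou_weight[of x]
    by (simp del: inner_scaleR_left)
  also have "\<dots> = (\<integral>\<omega>. first_order f ?a ?c k (ou_int A L1 t \<omega>, mark_sum (jump_data t) E \<xi> t \<omega>) \<partial>M)"
  proof (rule integral_cong_AE)
    have [measurable]: "ou_proc A L x t \<in> borel_measurable M" for x using t by (intro ou_proc_measurable) simp
    show "(\<lambda>\<omega>. ?F (x + k) \<omega> - ?F x \<omega> + (?F x \<omega> *\<^sub>R weight t \<omega>) \<bullet> k) \<in> borel_measurable M" by measurable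
    show "(\<lambda>\<omega>. first_order f ?a ?c k (ou_int A L1 t \<omega>, mark_sum (jump_data t) E \<xi> t \<omega>)) \<in> borel_measurable M" by measurable
    have "AE \<omega> in M. good t \<omega>" using t by (intro AE_good) simp
    with AE_space show "AE \<omega> in M. ?F (x + k) \<omega> - ?F x \<omega> + (?F x \<omega> *\<^sub>R weight t \<omega>) \<bullet> k
      = first_order f ?a ?c k (ou_int A L1 t \<omega>, mark_sum (jump_data t) E \<xi> t \<omega>)"
    proof eventually_elim
      case (elim \<omega>)
      let ?w = "?a + ou_int A L1 t \<omega> + mark_sum (\<lambda>s z. mexp ((t - s) *\<^sub>R A) *v z) E \<xi> t \<omega>"
      have "ou_proc A L x t \<omega> = ?w" "ou_proc A L (x + k) t \<omega> = ?w + ?c"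
        using ou_proc_decomp[OF elim] t by (auto simp: mark_sum_jump_data matrix_vector_right_distrib add_ac)
      then show ?case
        by (simp add: first_order_def mark_sum_jump_data weight_def indicator_def)
    qed
  qed
  also have "\<bar>\<dots>\<bar> \<le> K / lam * D"
  proof (rule indep_rv_integral_bound[OF indep])
    show "AE \<omega> in M. \<bar>\<integral>\<omega>'. first_order f ?a ?c k (ou_int A L1 t \<omega>, mark_sum (jump_data t) E \<xi> t \<omega>') \<partial>M\<bar> \<le> K / lam * D"
      using first_order_fixed_bound[OF D] by simp
  qed (auto intro!: integrable_first_order)
  finally show ?thesis .
qed

lemma gderiv_P1: "GDERIV (P1 t f) x :> DP1 t f x"
  unfolding gderiv_def has_derivative_at_alt
proof (intro conjI allI impI)
  show "bounded_linear (\<lambda>h. h \<bullet> DP1 t f x)" by (rule bounded_linear_inner_left)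
  fix e :: real assume e: "0 < e"
  obtain \<theta> where \<theta>: "\<And>v. v \<bullet> (A *v v) \<le> - \<theta> * (norm v)\<^sup>2" using dissipative_ex[of A] by blast
  define C where "C = exp (max (- \<theta>) 0 * t)"
  have C: "0 < C" by (simp add: C_def)
  \<comment> \<open>Chosen so that \<open>K / lam * \<eta> * C\<close> becomes
    \<open>K / (K + 1) * e\<close>, which is at most \<open>e\<close>; \<open>K + 1\<close> avoids
    division by zero when \<open>K = 0\<close>.\<close>
  define \<eta> where "\<eta> = e * lam / ((K + 1) * C)"
  have \<eta>: "0 < \<eta>" using e lam_pos K_nonneg C by (simp add: \<eta>_def)
  obtain r where r: "r > 0" "\<And>w. norm w < r \<Longrightarrow> (\<integral>z. \<bar>taylor_rem w z\<bar> \<partial>lborel) \<le> \<eta> * norm w"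
    using integral_taylor_rem_small[OF \<eta>] by blast
  show "\<exists>d>0. \<forall>y. norm (y - x) < d \<longrightarrow> norm (P1 t f y - P1 t f x - (y - x) \<bullet> DP1 t f x) \<le> e * norm (y - x)"
  proof (intro exI[of _ "r / C"] conjI allI impI)
    \<comment> \<open>The exponentials at times in \<open>[0, t]\<close> enlarge norms by at most
      the factor \<open>C\<close>, so this radius keeps every propagated displacement below
      \<open>r\<close>.\<close>
    show "0 < r / C" using r C by simp
    fix y assume y: "norm (y - x) < r / C"
    have "(\<integral>z. \<bar>taylor_rem (mexp (s *\<^sub>R A) *v (y - x)) z\<bar> \<partial>lborel) \<le> \<eta> * (C * norm (y - x))" if s: "0 \<le> s" "s \<le> t" for s
    proof -
      have le: "norm (mexp (s *\<^sub>R A) *v (y - x)) \<le> C * norm (y - x)"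
        unfolding C_def by (rule norm_mexp_le[OF \<theta> s])
      also have "\<dots> < r" using y C by (simp add: pos_less_divide_eq mult.commute)
      finally have "(\<integral>z. \<bar>taylor_rem (mexp (s *\<^sub>R A) *v (y - x)) z\<bar> \<partial>lborel) \<le> \<eta> * norm (mexp (s *\<^sub>R A) *v (y - x))"
        by (rule r(2))
      also have "\<dots> \<le> \<eta> * (C * norm (y - x))" using le \<eta> by (intro mult_left_mono) auto
      finally show ?thesis .
    qed
    from P1_expansion[OF this, of x] have "\<bar>P1 t f y - P1 t f x - (y - x) \<bullet> DP1 t f x\<bar> \<le> K / lam * (\<eta> * (C * norm (y - x)))"
      by simp
    also have "\<dots> = K / (K + 1) * (e * norm (y - x))"
    proof -
      have "C \<noteq> 0" "lam \<noteq> 0" "K + 1 \<noteq> 0" using C lam_pos K_nonneg by auto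
      then show ?thesis by (simp add: \<eta>_def)
    qed
    also have "\<dots> \<le> 1 * (e * norm (y - x))"
      using K_nonneg e by (intro mult_right_mono) (auto simp: divide_le_eq)
    finally show "norm (P1 t f y - P1 t f x - (y - x) \<bullet> DP1 t f x) \<le> e * norm (y - x)" by simp
  qed
qed

text \<open>\<open>K\<close> bounds \<open>f\<close>, the exponential bounds the propagators in the
  weight, and the rest is the mean of \<open>average_score\<close>.\<close>

lemma norm_DP1_le:
  assumes diss: "\<And>v. v \<bullet> (A *v v) \<le> - \<theta> * (norm v)\<^sup>2"
  shows "norm (DP1 t f x) \<le> K * (exp (max (- \<theta>) 0 * t) * (1 - exp (- lam * t)) / lam) * (\<integral>z. norm (grad rho z) \<partial>lborel)"
proof -
  let ?C = "exp (max (- \<theta>) 0 * t)"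
  let ?H = "\<lambda>\<omega>. (f (ou_proc A L x t \<omega>) * indicator {\<omega>. 1 \<le> count_proc E t \<omega>} \<omega>) *\<^sub>R weight t \<omega>"
  have "norm (DP1 t f x) \<le> (\<integral>\<omega>. norm (?H \<omega>) \<partial>M)"
    unfolding DP1_def norm_minus_cancel by (rule integral_norm_bound)
  also have "\<dots> \<le> (\<integral>\<omega>. K * (?C * average_score t \<omega>) \<partial>M)"
  proof (rule integral_mono_AE)
    show "integrable M (\<lambda>\<omega>. norm (?H \<omega>))" using integrable_f_ou_weight by (rule integrable_norm)
    show "integrable M (\<lambda>\<omega>. K * (?C * average_score t \<omega>))"
      using integrable_average_score[of t] t by simp
    have "AE \<omega> in M. good t \<omega>" using t by (intro AE_good) simp
    then show "AE \<omega> in M. norm (?H \<omega>) \<le> K * (?C * average_score t \<omega>)"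
    proof eventually_elim
      case (elim \<omega>)
      have "norm (?H \<omega>) \<le> K * norm (weight t \<omega>)"
        using fK K_nonneg by (auto simp: indicator_def intro!: mult_right_mono)
      also have "\<dots> \<le> K * (?C * average_score t \<omega>)"
        using K_nonneg norm_weight_le[OF diss elim] by (intro mult_left_mono)
      finally show ?case .
    qed
  qed
  also have "\<dots> = K * (?C * ((1 - exp (- lam * t)) * ((\<integral>z. norm (grad rho z) \<partial>lborel) / lam)))"
    using t by (simp add: integral_average_score)
  finally show ?thesis by (simp add: ac_simps)
qed

end

end

lemma abs_le_sup_norm:
  fixes f :: "real^'n \<Rightarrow> real"
  assumes "bounded (range f)" shows "\<bar>f z\<bar> \<le> sup_norm f"
proof -
  obtain B where "\<And>z. \<bar>f z\<bar> \<le> B" using assms by (auto simp: bounded_iff)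
  then show ?thesis unfolding sup_norm_def by (intro cSUP_upper bdd_aboveI2) auto
qed

theorem theorem3p1:
  fixes M :: "'w measure"
    and A :: "real^'n^'n"
    and \<nu> :: "(real^'n) measure"
    and rho0 :: "real^'n \<Rightarrow> real"
    and lam0 :: real
    and E :: "nat \<Rightarrow> 'w \<Rightarrow> real"
    and \<xi> :: "nat \<Rightarrow> 'w \<Rightarrow> real^'n"
    and L1 L :: "real \<Rightarrow> 'w \<Rightarrow> real^'n"
  assumes prob: "prob_space M"
    and rho_nonneg: "\<And>z. 0 \<le> rho0 z"
    and rho_diff: "\<And>z. rho0 differentiable (at z)"
    and nu_ge: "\<And>B. B \<in> sets borel \<Longrightarrow> emeasure (density lborel rho0) B \<le> emeasure \<nu> B"
    and lambda_pos: "0 < lam0"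
    and lambda_def: "(\<integral>\<^sup>+z. ennreal (rho0 z) \<partial>lborel) = ennreal lam0"
    and grad_int: "\<exists>\<epsilon>>0. (\<integral>\<^sup>+z. (SUP x\<in>cball z \<epsilon>. ennreal (norm (grad rho0 x))) \<partial>lborel) < \<infinity>"
    and E_indep: "prob_space.indep_vars M (\<lambda>_. borel) E UNIV"
    and E_exp: "\<And>j. distributed M lborel (E j) (\<lambda>s. ennreal (exponential_density lam0 s))"
    and xi_indep: "prob_space.indep_vars M (\<lambda>_. borel) \<xi> {1..}"
    and xi_distr: "\<And>i. 1 \<le> i \<Longrightarrow> distributed M lborel (\<xi> i) (\<lambda>z. ennreal (rho0 z / lam0))"
    and xi_E_indep: "indep_rv M
        (Pi\<^sub>M UNIV (\<lambda>_. borel)) (\<lambda>\<omega> j. E j \<omega>)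
        (Pi\<^sub>M {1..} (\<lambda>_. borel)) (\<lambda>\<omega>. restrict (\<lambda>i. \<xi> i \<omega>) {1..})"
    and L1_levy: "levy_process M L1"
    and L1_measure: "\<And>B. B \<in> sets borel \<Longrightarrow> 0 \<notin> closure B \<Longrightarrow>
        jump_intensity M L1 B + emeasure (density lborel rho0) B = emeasure \<nu> B"
    and L1_indep: "indep_rv M
        (Pi\<^sub>M {0..} (\<lambda>_. borel)) (\<lambda>\<omega>. restrict (\<lambda>t. L1 t \<omega>) {0..})
        (Pi\<^sub>M {0..} (\<lambda>_. borel)) (\<lambda>\<omega>. restrict (\<lambda>t. compound_poisson E \<xi> t \<omega>) {0..})"
    and L_def: "\<And>t \<omega>. L t \<omega> = L1 t \<omega> + compound_poisson E \<xi> t \<omega>"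
    and L_levy: "levy_process M L"
    and L_measure: "has_levy_measure M L \<nu>"
  shows
   "(\<forall>t>0. \<forall>f. f \<in> borel_measurable borel \<longrightarrow> bounded (range f) \<longrightarrow>
      (\<forall>x. (\<lambda>y. \<integral>\<omega>. f (ou_proc A L y t \<omega>) * indicator {\<omega>. 1 \<le> count_proc E t \<omega>} \<omega> \<partial>M)
              differentiable (at x) \<and>
           GDERIV (\<lambda>y. \<integral>\<omega>. f (ou_proc A L y t \<omega>) * indicator {\<omega>. 1 \<le> count_proc E t \<omega>} \<omega> \<partial>M) x :>
             - (\<integral>\<omega>. (f (ou_proc A L x t \<omega>) * indicator {\<omega>. 1 \<le> count_proc E t \<omega>} \<omega>) *\<^sub>R
                  ((1 / real (count_proc E t \<omega>)) *\<^sub>R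
                    (\<Sum>i\<in>{1..count_proc E t \<omega>}.
                       mexp (jump_time E i \<omega> *\<^sub>R transpose A) *v grad (\<lambda>z. ln (rho0 z)) (\<xi> i \<omega>))) \<partial>M)))
    \<and> (\<forall>\<theta>::real. (\<forall>v. v \<bullet> (A *v v) \<le> - \<theta> * (norm v)\<^sup>2) \<longrightarrow>
        (\<forall>t>0. \<forall>f. f \<in> borel_measurable borel \<longrightarrow> bounded (range f) \<longrightarrow>
          (\<forall>x. norm (grad (\<lambda>y. \<integral>\<omega>. f (ou_proc A L y t \<omega>) * indicator {\<omega>. 1 \<le> count_proc E t \<omega>} \<omega> \<partial>M) x)
                \<le> sup_norm f * (exp (max (- \<theta>) 0 * t) * (1 - exp (- lam0 * t)) / lam0)
                   * (\<integral>z. norm (grad rho0 z) \<partial>lborel))))"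
proof -
  obtain \<epsilon> where \<epsilon>: "\<epsilon> > 0" "(\<integral>\<^sup>+z. (SUP x\<in>cball z \<epsilon>. ennreal (norm (grad rho0 x))) \<partial>lborel) < \<infinity>"
    using grad_int by blast
  interpret prob_space M by (rule prob)
  interpret ou_setup M rho0 \<epsilon> lam0 E \<xi> A L1 L
  proof
    show "0 \<le> rho0 z" "rho0 differentiable (at z)" for z by (rule rho_nonneg rho_diff)+
    show "0 < \<epsilon>" "(\<integral>\<^sup>+z. (SUP x\<in>cball z \<epsilon>. ennreal (norm (grad rho0 x))) \<partial>lborel) < \<infinity>" by (rule \<epsilon>)+
    show "L t \<omega> = L1 t \<omega> + compound_poisson E \<xi> t \<omega>" for t \<omega> by (rule L_def)
  qed (use lambda_pos lambda_def E_indep E_exp xi_indep xi_distr xi_E_indep L1_indep L1_levy L_levy in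
      \<open>auto simp: levy_process_def\<close>)
  have weight: "weight t \<omega> = (1 / real (count_proc E t \<omega>)) *\<^sub>R
      (\<Sum>i\<in>{1..count_proc E t \<omega>}. mexp (jump_time E i \<omega> *\<^sub>R transpose A) *v grad (\<lambda>z. ln (rho0 z)) (\<xi> i \<omega>))" for t \<omega>
    unfolding weight_def mark_sum_def score_def ..
  have gderiv: "GDERIV (P1 t f) x :> DP1 t f x"
    if "0 < t" "f \<in> borel_measurable borel" "bounded (range f)" for t f x
    \<comment> \<open>The generic bound \<open>K\<close> is taken to be \<open>sup_norm f\<close>,
      finite because the range of \<open>f\<close> is bounded.\<close>
    using that(1,2) abs_le_sup_norm[OF that(3)] by (rule gderiv_P1)
  show ?thesis
  proof (intro conjI allI impI)
    fix t :: real and f :: "real^'n \<Rightarrow> real" and x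
    assume tf: "0 < t" "f \<in> borel_measurable borel" "bounded (range f)"
    show "GDERIV (\<lambda>y. \<integral>\<omega>. f (ou_proc A L y t \<omega>) * indicator {\<omega>. 1 \<le> count_proc E t \<omega>} \<omega> \<partial>M) x :>
             - (\<integral>\<omega>. (f (ou_proc A L x t \<omega>) * indicator {\<omega>. 1 \<le> count_proc E t \<omega>} \<omega>) *\<^sub>R
                  ((1 / real (count_proc E t \<omega>)) *\<^sub>R
                    (\<Sum>i\<in>{1..count_proc E t \<omega>}.
                       mexp (jump_time E i \<omega> *\<^sub>R transpose A) *v grad (\<lambda>z. ln (rho0 z)) (\<xi> i \<omega>))) \<partial>M)"
      using gderiv[OF tf, of x] unfolding P1_def[abs_def] DP1_def weight .
    then show "(\<lambda>y. \<integral>\<omega>. f (ou_proc A L y t \<omega>) * indicator {\<omega>. 1 \<le> count_proc E t \<omega>} \<omega> \<partial>M) differentiable (at x)"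
      unfolding gderiv_def by (rule differentiableI)
  next
    fix \<theta> t :: real and f :: "real^'n \<Rightarrow> real" and x
    assume diss: "\<forall>v. v \<bullet> (A *v v) \<le> - \<theta> * (norm v)\<^sup>2"
      and tf: "0 < t" "f \<in> borel_measurable borel" "bounded (range f)"
    have "norm (DP1 t f x) \<le> sup_norm f * (exp (max (- \<theta>) 0 * t) * (1 - exp (- lam0 * t)) / lam0)
        * (\<integral>z. norm (grad rho0 z) \<partial>lborel)"
      using tf(1,2) abs_le_sup_norm[OF tf(3)] diss[rule_format] by (rule norm_DP1_le)
    then show "norm (grad (\<lambda>y. \<integral>\<omega>. f (ou_proc A L y t \<omega>) * indicator {\<omega>. 1 \<le> count_proc E t \<omega>} \<omega> \<partial>M) x)
        \<le> sup_norm f * (exp (max (- \<theta>) 0 * t) * (1 - exp (- lam0 * t)) / lam0) * (\<integral>z. norm (grad rho0 z) \<partial>lborel)"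
      using grad_eqI[OF gderiv[OF tf, of x]] unfolding P1_def[abs_def] by simp
  qed
qed

end
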